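(* Let $p>3$ be a prime. Then $$\sum_{k=0}^{\frac{p-3}{2}}\frac{\binom{2k}{k}^2H_k}{(2k+1)16^k}\equiv 4q_p(2)^2+2\left(\frac{-1}{p}\right)\left(E_{2p-4}-2E_{p-3}\right)+\frac{7}{12}pB_{p-3}\pmod{p^2},$$ and $$\sum_{k=0}^{\frac{p-3}{2}}\frac{\binom{2k}{k}^2H_{2k}}{(2k+1)16^k}\equiv -2\left(\frac{-1}{p}\right)E_{p-3}\pmod{p}.$$
   Context: $H_n=\sum_{0<k\le n}1/k$ denotes the $n$-th harmonic number ($H_0=0$). $q_p(2)=(2^{p-1}-1)/p$ is the Fermat quotient. $\left(\frac{\cdot}{p}\right)$ is the Legendre symbol. The Bernoulli numbers are defined by $B_0=1$ and $\sum_{k=0}^{n-1}\binom{n}{k}B_k=0$ for $n\ge 2$. The Euler numbers are defined by $E_0=1$ and $E_n=-\sum_{k=1}^{\lfloor n/2\rfloor}\binom{n}{2k}E_{n-2k}$ for $n\ge1$. Congruences modulo powers of $p$ are between rational numbers whose denominators are coprime to $p$ (i.e. in $\mathbb{Z}_{(p)}$). *)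

theory Defs
  imports "HOL-Number_Theory.Number_Theory"
begin

(* The library's harm lives in real normed fields; the congruences here are between rationals. *)
definition harmonic :: "nat \<Rightarrow> rat" where
  "harmonic n = (\<Sum>k\<in>{0<..n}. 1 / of_nat k)"

definition fermat_quotient :: "nat \<Rightarrow> int \<Rightarrow> rat" where
  "fermat_quotient p a = (of_int a ^ (p - 1) - 1) / of_nat p"

(* The relation sum_{k<m} (m choose k) B_k = 0 for m >= 2, solved for its last term with m = n + 1;
   see bernoulli_number_recurrence. In particular B_1 = -1/2. *)
fun bernoulli_number :: "nat \<Rightarrow> rat" where
  "bernoulli_number n =
     (if n = 0 then 1
      else - (\<Sum>k<n. of_nat (Suc n choose k) * bernoulli_number k) / of_nat (Suc n))"

declare bernoulli_number.simps [simp del]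

lemma bernoulli_number_0: "bernoulli_number 0 = 1"
  by (simp add: bernoulli_number.simps)

lemma bernoulli_number_recurrence:
  assumes "n \<ge> 2"
  shows "(\<Sum>k=0..n-1. of_nat (n choose k) * bernoulli_number k) = 0"
proof -
  obtain m where n: "n = Suc m" and m: "m > 0"
    using assms by (cases n) auto
  have "bernoulli_number m =
      - (\<Sum>k<m. of_nat (Suc m choose k) * bernoulli_number k) / of_nat (Suc m)"
    using m by (subst bernoulli_number.simps) simp
  then have "of_nat (Suc m) * bernoulli_number m =
      - (\<Sum>k<m. of_nat (Suc m choose k) * bernoulli_number k)"
    by (simp del: of_nat_Suc binomial_Suc_Suc)
  moreover have "{0..n-1} = insert m {..<m}"
    using n by auto
  moreover have "Suc m choose m = Suc m"
    using binomial_symmetric[of m "Suc m"] by (simp del: binomial_Suc_Suc)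
  ultimately show ?thesis
    by (simp add: n del: of_nat_Suc binomial_Suc_Suc)
qed

fun euler_number :: "nat \<Rightarrow> int" where
  "euler_number n =
     (if n = 0 then 1
      else - (\<Sum>k=1..n div 2. int (n choose (2*k)) * euler_number (n - 2*k)))"

declare euler_number.simps [simp del]

(* Z_(p) as a subring of the rationals; quotient_of returns the reduced fraction. *)
definition localized_ints :: "nat \<Rightarrow> rat set" where
  "localized_ints p = {x. coprime (snd (quotient_of x)) (int p)}"

(* Congruence modulo p^m in Z_(p); both sides are required to lie in Z_(p). *)
definition rat_cong :: "nat \<Rightarrow> nat \<Rightarrow> rat \<Rightarrow> rat \<Rightarrow> bool" where
  "rat_cong p m x y \<longleftrightarrow>
     x \<in> localized_ints p \<and> y \<in> localized_ints p \<and>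
     (\<exists>z\<in>localized_ints p. x - y = of_nat p ^ m * z)"

end

theory Submission
  imports Defs "HOL-Computational_Algebra.Computational_Algebra"
begin

text \<open>Write $p = 2n + 1$. Modulo $p^2$ the factor $\binom{2k}k^2/16^k$ is
  $(-1)^k\binom nk\binom{n+k}k$, and with these coefficients the sums up to $k = n$ have closed forms:
  with $T = \sum_{j \le n} (-1)^j/j$, they are $2T/p$ for the weight $H_k/(2k+1)$ and
  $(2T - H_n)/p$ for the weight $H_{2k}/(2k+1)$.
  Subtracting the term $k = n$ leaves $2T - H_n$ to be determined modulo $p^3$. Pairing $j$ with
  $p - j$ reduces it to $H_{p-1}$ and $\sum_{j \le n} (-1)^j/(p-2j)^2$; these are expressed by
  $B_{p-3}$ and by $E_{2p-4} - 2E_{p-3}$ through alternating power sums, because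
  $u^{2p-4} - 2u^{p-3} \equiv -u^{-2}$ modulo $p^2$ for units $u$. The term $k = n$ supplies the
  Fermat quotient by Morley's congruence.\<close>

section \<open>Localized integers\<close>

text \<open>The closed forms include the summand \<open>k = n\<close>, the only one whose
  denominator \<open>2 * k + 1\<close> is divisible by \<open>p\<close>. All identities are
  therefore multiplied by \<open>p\<close>, and every ingredient is needed one power of
  \<open>p\<close> beyond the claimed modulus.

  The Euler numbers occur with weights 1 and -2 because, for a unit \<open>u\<close> and
  \<open>x = u^(p-1)\<close>, the quantity \<open>x^2 - 2x + 1 = (x-1)^2\<close> is divisible by
  \<open>p^2\<close>, while a single power of \<open>u\<close> would determine \<open>u^(-2)\<close>
  only modulo \<open>p\<close>.

  The common currency is \<open>W\<close>, the alternating sum of inverse cubes, needed only modulo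
  \<open>p\<close>. It enters twice, as \<open>2/3 * p^2 * W\<close> through \<open>H_(p-1)\<close>
  and as \<open>1/2 * p^2 * W\<close> through the part of the Euler expansion that is linear in
  \<open>p\<close>. As \<open>W\<close> is congruent to \<open>-B/2\<close> with
  \<open>B = B_(p-3)\<close>, this produces the constant
  \<open>7/12 = (2/3 + 1/2)/2\<close>.\<close>

lemma localized_ints_iff:
  "x \<in> localized_ints p \<longleftrightarrow> (\<exists>a b. b \<noteq> 0 \<and> coprime b (int p) \<and> x = of_int a / of_int b)"
proof
  assume "x \<in> localized_ints p"
  moreover obtain a b where ab: "quotient_of x = (a, b)"
    by fastforce
  ultimately show "\<exists>a b. b \<noteq> 0 \<and> coprime b (int p) \<and> x = of_int a / of_int b"
    using quotient_of_div[OF ab] quotient_of_denom_pos[OF ab]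
    by (intro exI[of _ a] exI[of _ b]) (auto simp: localized_ints_def)
next
  assume "\<exists>a b. b \<noteq> 0 \<and> coprime b (int p) \<and> x = of_int a / of_int b"
  then obtain a b where b: "b \<noteq> 0" "coprime b (int p)" "x = of_int a / of_int b"
    by blast
  obtain c d where cd: "quotient_of x = (c, d)"
    by fastforce
  have d: "d > 0" "coprime c d" "x = of_int c / of_int d"
    using quotient_of_denom_pos[OF cd] quotient_of_coprime[OF cd] quotient_of_div[OF cd] by auto
  have "(of_int (a * d) :: rat) = of_int (c * b)"
    using b d by (simp add: field_simps)
  then have "a * d = c * b"
    by (simp only: of_int_eq_iff)
  \<comment> \<open>The reduced denominator divides any other denominator, so it inherits
    coprimality to \<open>p\<close>; unreduced fractions may thus serve as witnesses.\<close>
  then have "d dvd b"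
    using d(2) by (metis coprime_commute coprime_dvd_mult_right_iff dvd_triv_right)
  then show "x \<in> localized_ints p"
    using b(2) cd by (auto simp: localized_ints_def intro: coprime_divisors[of d b "int p" "int p"])
qed

lemma localized_ints_of_int [simp]: "of_int a \<in> localized_ints p"
  unfolding localized_ints_iff by (rule exI[of _ a], rule exI[of _ 1]) simp

lemma localized_ints_of_nat [simp]: "of_nat a \<in> localized_ints p"
  using localized_ints_of_int[of "int a" p] by simp

lemma localized_ints_numeral [simp]: "numeral a \<in> localized_ints p"
  using localized_ints_of_int[of "numeral a" p] by simp

lemma localized_ints_0 [simp]: "0 \<in> localized_ints p"
  using localized_ints_of_int[of 0 p] by simp

lemma localized_ints_1 [simp]: "1 \<in> localized_ints p"
  using localized_ints_of_int[of 1 p] by simp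

lemma localized_ints_mult:
  assumes "x \<in> localized_ints p" "y \<in> localized_ints p"
  shows "x * y \<in> localized_ints p"
proof -
  obtain a b where 1: "b \<noteq> 0" "coprime b (int p)" "x = of_int a / of_int b"
    using assms(1) unfolding localized_ints_iff by blast
  obtain c d where 2: "d \<noteq> 0" "coprime d (int p)" "y = of_int c / of_int d"
    using assms(2) unfolding localized_ints_iff by blast
  show ?thesis
    unfolding localized_ints_iff using 1 2
    by (intro exI[of _ "a * c"] exI[of _ "b * d"]) simp
qed

lemma localized_ints_add:
  assumes "x \<in> localized_ints p" "y \<in> localized_ints p"
  shows "x + y \<in> localized_ints p"
proof -
  obtain a b where 1: "b \<noteq> 0" "coprime b (int p)" "x = of_int a / of_int b"
    using assms(1) unfolding localized_ints_iff by blast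
  obtain c d where 2: "d \<noteq> 0" "coprime d (int p)" "y = of_int c / of_int d"
    using assms(2) unfolding localized_ints_iff by blast
  show ?thesis
    unfolding localized_ints_iff using 1 2
    by (intro exI[of _ "a * d + c * b"] exI[of _ "b * d"]) (simp add: field_simps)
qed

lemma localized_ints_minus: "x \<in> localized_ints p \<Longrightarrow> - x \<in> localized_ints p"
  using localized_ints_mult[of "-1" p x] localized_ints_of_int[of "-1" p] by simp

lemma localized_ints_diff:
  "x \<in> localized_ints p \<Longrightarrow> y \<in> localized_ints p \<Longrightarrow> x - y \<in> localized_ints p"
  using localized_ints_add[of x p "- y"] localized_ints_minus[of y p] by simp

lemma localized_ints_power: "x \<in> localized_ints p \<Longrightarrow> x ^ k \<in> localized_ints p"
  by (induction k) (auto intro: localized_ints_mult)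

lemma localized_ints_sum:
  "(\<And>i. i \<in> A \<Longrightarrow> f i \<in> localized_ints p) \<Longrightarrow> sum f A \<in> localized_ints p"
  by (induction A rule: infinite_finite_induct) (auto intro: localized_ints_add)

lemma localized_ints_prod:
  "(\<And>i. i \<in> A \<Longrightarrow> f i \<in> localized_ints p) \<Longrightarrow> prod f A \<in> localized_ints p"
  by (induction A rule: infinite_finite_induct) (auto intro: localized_ints_mult)

lemma localized_ints_divide:
  "x \<in> localized_ints p \<Longrightarrow> inverse y \<in> localized_ints p \<Longrightarrow> x / y \<in> localized_ints p"
  by (simp add: divide_inverse localized_ints_mult)

lemma localized_ints_inverse_mult:
  "inverse x \<in> localized_ints p \<Longrightarrow> inverse y \<in> localized_ints p \<Longrightarrow>
   inverse (x * y) \<in> localized_ints p"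
  by (simp add: localized_ints_mult)

lemma localized_ints_inverse_power:
  "inverse x \<in> localized_ints p \<Longrightarrow> inverse (x ^ k) \<in> localized_ints p"
  by (simp add: power_inverse [symmetric] localized_ints_power)

lemmas localized_ints_intros =
  localized_ints_add localized_ints_diff localized_ints_minus localized_ints_mult
  localized_ints_power localized_ints_sum localized_ints_prod localized_ints_divide
  localized_ints_inverse_mult localized_ints_inverse_power
  localized_ints_of_int localized_ints_of_nat localized_ints_numeral
  localized_ints_0 localized_ints_1

text \<open>Congruences become memberships, so a chain of congruences is a single linear combination
  of members checked by ring normalisation; integrality of the two sides is settled
  separately.\<close>

definition local_ideal :: "nat \<Rightarrow> nat \<Rightarrow> rat set" where
  "local_ideal p m = {x. \<exists>z\<in>localized_ints p. x = of_nat p ^ m * z}"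

lemma rat_cong_iff:
  "rat_cong p m x y \<longleftrightarrow>
     x \<in> localized_ints p \<and> y \<in> localized_ints p \<and> x - y \<in> local_ideal p m"
  by (auto simp: rat_cong_def local_ideal_def)

lemma local_idealI:
  "z \<in> localized_ints p \<Longrightarrow> x = of_nat p ^ m * z \<Longrightarrow> x \<in> local_ideal p m"
  by (auto simp: local_ideal_def)

lemma local_ideal_localized: "x \<in> local_ideal p m \<Longrightarrow> x \<in> localized_ints p"
  by (auto simp: local_ideal_def intro: localized_ints_intros)

lemma local_ideal_0 [simp]: "0 \<in> local_ideal p m"
  by (rule local_idealI[of 0]) simp_all

lemma local_ideal_add:
  assumes "x \<in> local_ideal p m" "y \<in> local_ideal p m"
  shows "x + y \<in> local_ideal p m"
proof -
  obtain u v where "u \<in> localized_ints p" "v \<in> localized_ints p"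
    "x = of_nat p ^ m * u" "y = of_nat p ^ m * v"
    using assms by (auto simp: local_ideal_def)
  then show ?thesis
    by (intro local_idealI[of "u + v"] localized_ints_add) (auto simp: algebra_simps)
qed

lemma local_ideal_mult:
  assumes "x \<in> local_ideal p k" "y \<in> local_ideal p m"
  shows "x * y \<in> local_ideal p (k + m)"
proof -
  obtain u v where "u \<in> localized_ints p" "v \<in> localized_ints p"
    "x = of_nat p ^ k * u" "y = of_nat p ^ m * v"
    using assms by (auto simp: local_ideal_def)
  then show ?thesis
    by (intro local_idealI[of "u * v"] localized_ints_mult) (auto simp: power_add)
qed

lemma local_ideal_trivial: "x \<in> localized_ints p \<Longrightarrow> x \<in> local_ideal p 0"
  by (rule local_idealI[of x]) simp_all

lemma local_ideal_times:
  "c \<in> localized_ints p \<Longrightarrow> x \<in> local_ideal p m \<Longrightarrow> c * x \<in> local_ideal p m"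
  using local_ideal_mult[of c p 0 x m] local_ideal_trivial by simp

lemma local_ideal_minus: "x \<in> local_ideal p m \<Longrightarrow> - x \<in> local_ideal p m"
  using local_ideal_times[of "-1" p x m] localized_ints_of_int[of "-1" p] by simp

lemma local_ideal_diff:
  "x \<in> local_ideal p m \<Longrightarrow> y \<in> local_ideal p m \<Longrightarrow> x - y \<in> local_ideal p m"
  using local_ideal_add[of x p m "- y"] local_ideal_minus[of y p m] by simp

lemma local_ideal_sum:
  "(\<And>i. i \<in> A \<Longrightarrow> f i \<in> local_ideal p m) \<Longrightarrow> sum f A \<in> local_ideal p m"
  by (induction A rule: infinite_finite_induct) (auto intro: local_ideal_add)

lemma local_ideal_mono:
  assumes "x \<in> local_ideal p m" "k \<le> m"
  shows "x \<in> local_ideal p k"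
proof -
  obtain u where "u \<in> localized_ints p" "x = of_nat p ^ m * u"
    using assms by (auto simp: local_ideal_def)
  then show ?thesis using assms(2)
    by (intro local_idealI[of "of_nat p ^ (m - k) * u"] localized_ints_intros)
       (auto simp: power_add [symmetric] mult.assoc [symmetric])
qed

lemma local_ideal_power: "of_nat p ^ m \<in> local_ideal p m"
  by (rule local_idealI[of 1]) simp_all

text \<open>Cancelling \<open>p\<close> leads back from a congruence for \<open>p\<close> times a
  sum to the sum itself; with \<open>m = 0\<close> it yields integrality of a quotient by
  \<open>p\<close>.\<close>

lemma local_ideal_Suc_iff:
  assumes "p > 0"
  shows "of_nat p * x \<in> local_ideal p (Suc m) \<longleftrightarrow> x \<in> local_ideal p m"
  using assms by (auto simp: local_ideal_def)

lemma local_ideal_of_int: "int p dvd a \<Longrightarrow> of_int a \<in> local_ideal p 1"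
  by (elim dvdE) (auto intro!: local_idealI)

section \<open>Units of the localized integers\<close>

lemma inverse_of_int_localized:
  assumes "prime p" "\<not> int p dvd a"
  shows "inverse (of_int a) \<in> localized_ints p"
proof -
  have "coprime (int p) a"
    using assms by (simp add: prime_imp_coprime)
  moreover have "a \<noteq> 0"
    using assms by auto
  ultimately show ?thesis
    unfolding localized_ints_iff
    by (intro exI[of _ 1] exI[of _ a]) (auto simp: coprime_commute divide_inverse)
qed

lemma inverse_of_nat_localized:
  assumes "prime p" "0 < a" "a < p"
  shows "inverse (of_nat a) \<in> localized_ints p"
  using inverse_of_int_localized[of p "int a"] assms by (simp add: nat_dvd_not_less)

section \<open>Two combinatorial identities\<close>

text \<open>\<open>shifted_legendre n k\<close> is $(-1)^k \binom nk \binom{n+k}k$, and \<open>shifted_legendre_diff n k\<close> is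
  $(-1)^k \binom nk \binom{n+k-1}k$.\<close>

definition shifted_legendre :: "nat \<Rightarrow> nat \<Rightarrow> rat" where
  "shifted_legendre n k =
     (\<Prod>i=1..k. (of_nat i * (of_nat i - 1) - of_nat n * (of_nat n + 1)) / of_nat i ^ 2)"

definition shifted_legendre_diff :: "nat \<Rightarrow> nat \<Rightarrow> rat" where
  "shifted_legendre_diff n k = (\<Prod>i=1..k. ((of_nat i - 1) ^ 2 - of_nat n ^ 2) / of_nat i ^ 2)"

lemma shifted_legendre_diff_0 [simp]: "shifted_legendre_diff n 0 = 1"
  by (simp add: shifted_legendre_diff_def)

lemma shifted_legendre_diff_Suc:
  "of_nat (Suc k) ^ 2 * shifted_legendre_diff n (Suc k) =
     (of_nat k ^ 2 - of_nat n ^ 2) * shifted_legendre_diff n k"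
  unfolding shifted_legendre_diff_def
  by (simp add: prod.nat_ivl_Suc' del: of_nat_Suc)

lemma shifted_legendre_diff_self_Suc: "shifted_legendre_diff n (Suc n) = 0"
  using shifted_legendre_diff_Suc[of n n] by (simp del: of_nat_Suc)

text \<open>Since \<open>n * binom(n+k, k) = (n+k) * binom(n+k-1, k)\<close>.\<close>

lemma shifted_legendre_conv_diff:
  "of_nat n * shifted_legendre n k = (of_nat n + of_nat k) * shifted_legendre_diff n k"
proof (induction k)
  case 0
  then show ?case by (simp add: shifted_legendre_def shifted_legendre_diff_def)
next
  case (Suc k)
  have "of_nat n * (of_nat (Suc k) ^ 2 * shifted_legendre n (Suc k)) =
      (of_nat (Suc k) * of_nat k - of_nat n * (of_nat n + 1)) * (of_nat n * shifted_legendre n k)"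
    unfolding shifted_legendre_def by (simp add: prod.nat_ivl_Suc' del: of_nat_Suc)
  also have "\<dots> = (of_nat n + of_nat (Suc k)) *
      ((of_nat k ^ 2 - of_nat n ^ 2) * shifted_legendre_diff n k)"
    unfolding Suc.IH by (simp add: algebra_simps power2_eq_square)
  also have "\<dots> = of_nat (Suc k) ^ 2 *
      ((of_nat n + of_nat (Suc k)) * shifted_legendre_diff n (Suc k))"
    by (simp only: shifted_legendre_diff_Suc mult.left_commute[of "of_nat (Suc k) ^ 2"])
  finally show ?case
    by (simp del: of_nat_Suc)
qed

text \<open>Since \<open>(n+1) * binom(n, k) = (n+1-k) * binom(n+1, k)\<close>. With
  \<open>shifted_legendre_conv_diff\<close> this expresses the coefficients of degrees
  \<open>n\<close> and \<open>n + 1\<close> through the same number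
  \<open>shifted_legendre_diff (Suc n) k\<close>, which gives recurrences in the degree.\<close>

lemma shifted_legendre_pred_conv_diff:
  "of_nat (Suc n) * shifted_legendre n k =
     (of_nat (Suc n) - of_nat k) * shifted_legendre_diff (Suc n) k"
proof (induction k)
  case 0
  then show ?case by (simp add: shifted_legendre_def shifted_legendre_diff_def)
next
  case (Suc k)
  have "of_nat (Suc n) * (of_nat (Suc k) ^ 2 * shifted_legendre n (Suc k)) =
      (of_nat (Suc k) * of_nat k - of_nat n * (of_nat n + 1)) * (of_nat (Suc n) * shifted_legendre n k)"
    unfolding shifted_legendre_def by (simp add: prod.nat_ivl_Suc' del: of_nat_Suc)
  also have "\<dots> = (of_nat (Suc n) - of_nat (Suc k)) *
      ((of_nat k ^ 2 - of_nat (Suc n) ^ 2) * shifted_legendre_diff (Suc n) k)"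
    unfolding Suc.IH by (simp add: algebra_simps power2_eq_square)
  also have "\<dots> = of_nat (Suc k) ^ 2 *
      ((of_nat (Suc n) - of_nat (Suc k)) * shifted_legendre_diff (Suc n) (Suc k))"
    by (simp only: shifted_legendre_diff_Suc mult.left_commute[of "of_nat (Suc k) ^ 2"])
  finally show ?case
    by (simp del: of_nat_Suc)
qed

lemma shifted_legendre_self_Suc: "shifted_legendre n (Suc n) = 0"
  using shifted_legendre_pred_conv_diff[of n "Suc n"] by (simp del: of_nat_Suc)

text \<open>The recurrence reads \<open>n^2 d_k = k^2 d_k - (k+1)^2 d_(k+1)\<close>, a difference in
  \<open>k\<close>, so this is Abel summation. For \<open>N = n\<close> the boundary term
  vanishes.\<close>

lemma sum_shifted_legendre_diff_by_parts:
  "of_nat n ^ 2 * (\<Sum>k\<le>N. shifted_legendre_diff n k * w k) =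
     (\<Sum>k<N. of_nat (Suc k) ^ 2 * shifted_legendre_diff n (Suc k) * (w (Suc k) - w k))
     - w N * of_nat (Suc N) ^ 2 * shifted_legendre_diff n (Suc N)"
proof (induction N)
  case 0
  show ?case using shifted_legendre_diff_Suc[of 0 n] by simp
next
  case (Suc N)
  have "of_nat n ^ 2 * (\<Sum>k\<le>Suc N. shifted_legendre_diff n k * w k) =
      (\<Sum>k<N. of_nat (Suc k) ^ 2 * shifted_legendre_diff n (Suc k) * (w (Suc k) - w k))
     - w N * (of_nat (Suc N) ^ 2 * shifted_legendre_diff n (Suc N))
     + w (Suc N) * (of_nat n ^ 2 * shifted_legendre_diff n (Suc N))"
    using Suc.IH by (simp add: algebra_simps del: of_nat_Suc)
  also have "of_nat n ^ 2 * shifted_legendre_diff n (Suc N) =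
      of_nat (Suc N) ^ 2 * shifted_legendre_diff n (Suc N)
      - of_nat (Suc (Suc N)) ^ 2 * shifted_legendre_diff n (Suc (Suc N))"
    using shifted_legendre_diff_Suc[of "Suc N" n] by (simp only: left_diff_distrib)
  finally show ?case
    by (simp add: algebra_simps del: of_nat_Suc)
qed

lemma sum_shifted_legendre_diff_weighted:
  "of_nat n ^ 2 * (\<Sum>k\<le>n. shifted_legendre_diff n k * w k) =
     (\<Sum>k<n. of_nat (Suc k) ^ 2 * shifted_legendre_diff n (Suc k) * (w (Suc k) - w k))"
  using sum_shifted_legendre_diff_by_parts[of n w n]
  by (simp add: shifted_legendre_diff_self_Suc del: of_nat_Suc)

lemma sum_shifted_legendre_diff:
  "n > 0 \<Longrightarrow> (\<Sum>k\<le>n. shifted_legendre_diff n k) = 0"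
  using sum_shifted_legendre_diff_weighted[of n "\<lambda>_. 1"] by simp

text \<open>This is the shifted Legendre polynomial at 1. Coefficients of consecutive degrees add up
  to twice \<open>shifted_legendre_diff (Suc n) k\<close>, whose sum over \<open>k\<close> is
  zero.\<close>

lemma sum_shifted_legendre: "(\<Sum>k\<le>n. shifted_legendre n k) = (-1) ^ n"
proof (induction n)
  case 0
  then show ?case by (simp add: shifted_legendre_def)
next
  case (Suc n)
  have eq: "shifted_legendre (Suc n) k + shifted_legendre n k = 2 * shifted_legendre_diff (Suc n) k"
    for k
  proof -
    have "of_nat (Suc n) * (shifted_legendre (Suc n) k + shifted_legendre n k) =
        of_nat (Suc n) * (2 * shifted_legendre_diff (Suc n) k)"
      unfolding distrib_left shifted_legendre_conv_diff shifted_legendre_pred_conv_diff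
      by (simp add: algebra_simps)
    then show ?thesis
      by (simp del: of_nat_Suc)
  qed
  have "(\<Sum>k\<le>Suc n. shifted_legendre (Suc n) k) + (\<Sum>k\<le>Suc n. shifted_legendre n k) = 0"
    using sum_shifted_legendre_diff[of "Suc n"]
    by (simp only: sum.distrib [symmetric] eq sum_distrib_left [symmetric])
  then show ?case
    using Suc.IH by (simp add: shifted_legendre_self_Suc)
qed

text \<open>Writing \<open>a_n\<close> for \<open>shifted_legendre n k\<close> and \<open>d\<close>
  for \<open>shifted_legendre_diff (Suc n) k\<close>, the identity
  \<open>(2n+3) a_(n+1) - (2n+1) a_n = 2 (2k+1) d\<close> cancels the denominator
  \<open>2k+1\<close> for every weight. Closed forms then follow by adding up increments over the
  degree.\<close>

lemma sum_shifted_legendre_step: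
  "of_nat (2 * Suc n + 1) * (\<Sum>k\<le>Suc n. shifted_legendre (Suc n) k * w k / of_nat (2 * k + 1)) =
   of_nat (2 * n + 1) * (\<Sum>k\<le>n. shifted_legendre n k * w k / of_nat (2 * k + 1)) +
   2 * (\<Sum>k\<le>Suc n. shifted_legendre_diff (Suc n) k * w k)"
proof -
  have eq: "of_nat (2 * Suc n + 1) * (shifted_legendre (Suc n) k * w k / of_nat (2 * k + 1)) =
      of_nat (2 * n + 1) * (shifted_legendre n k * w k / of_nat (2 * k + 1)) +
      2 * (shifted_legendre_diff (Suc n) k * w k)" for k
  proof -
    have "of_nat (Suc n) * (of_nat (2 * Suc n + 1) * shifted_legendre (Suc n) k) =
      of_nat (Suc n) * (of_nat (2 * n + 1) * shifted_legendre n k +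
        2 * of_nat (2 * k + 1) * shifted_legendre_diff (Suc n) k)"
      unfolding distrib_left mult.left_commute[of "of_nat (Suc n)"]
        shifted_legendre_conv_diff shifted_legendre_pred_conv_diff
      by (simp add: algebra_simps)
    then have *: "of_nat (2 * Suc n + 1) * shifted_legendre (Suc n) k =
        of_nat (2 * n + 1) * shifted_legendre n k +
        2 * of_nat (2 * k + 1) * shifted_legendre_diff (Suc n) k"
      by (simp only: mult_cancel_left) simp
    have "of_nat (2 * Suc n + 1) * (shifted_legendre (Suc n) k * w k / of_nat (2 * k + 1)) =
      (of_nat (2 * Suc n + 1) * shifted_legendre (Suc n) k) * (w k / of_nat (2 * k + 1))"
      by simp
    also have "\<dots> = of_nat (2 * n + 1) * (shifted_legendre n k * w k / of_nat (2 * k + 1)) +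
      2 * (shifted_legendre_diff (Suc n) k * w k)"
      unfolding * by (simp add: field_simps)
    finally show ?thesis .
  qed
  have "(\<Sum>k\<le>n. shifted_legendre n k * w k / of_nat (2 * k + 1)) =
      (\<Sum>k\<le>Suc n. shifted_legendre n k * w k / of_nat (2 * k + 1))"
    by (simp add: shifted_legendre_self_Suc)
  then show ?thesis
    by (simp only: sum_distrib_left sum.distrib [symmetric] eq)
qed

lemma sum_shifted_legendre_odd:
  "of_nat (2 * n + 1) * (\<Sum>k\<le>n. shifted_legendre n k / of_nat (2 * k + 1)) = 1"
proof (induction n)
  case 0
  then show ?case by (simp add: shifted_legendre_def)
next
  case (Suc n)
  show ?case
    using sum_shifted_legendre_step[of n "\<lambda>_. 1"] Suc.IH sum_shifted_legendre_diff[of "Suc n"]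
    by (simp only: mult_1_right)
qed

section \<open>Closed forms for the harmonic weights\<close>

lemma harmonic_Suc: "harmonic (Suc n) = harmonic n + 1 / of_nat (Suc n)"
proof -
  have "{0<..Suc n} = insert (Suc n) {0<..n}" by auto
  then show ?thesis by (simp add: harmonic_def)
qed

lemma harmonic_0 [simp]: "harmonic 0 = 0"
  by (simp add: harmonic_def)

text \<open>The increments of \<open>harmonic\<close> cancel one factor of the square in the
  summation by parts, leaving \<open>k d_k\<close>, which \<open>shifted_legendre_conv_diff\<close>
  turns into \<open>n a_k - n d_k\<close>; both sums are known.\<close>

lemma sum_shifted_legendre_diff_harmonic:
  assumes "n > 0"
  shows "(\<Sum>k\<le>n. shifted_legendre_diff n k * harmonic k) = (-1) ^ n / of_nat n"
proof -
  have "of_nat n ^ 2 * (\<Sum>k\<le>n. shifted_legendre_diff n k * harmonic k) =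
      (\<Sum>k<n. of_nat (Suc k) * shifted_legendre_diff n (Suc k))"
    unfolding sum_shifted_legendre_diff_weighted harmonic_Suc
    by (intro sum.cong refl) (simp add: power2_eq_square field_simps del: of_nat_Suc)
  also have "\<dots> = (\<Sum>k\<le>n. of_nat k * shifted_legendre_diff n k)"
    by (simp add: sum.atMost_shift)
  also have "\<dots> = (\<Sum>k\<le>n. of_nat n * shifted_legendre n k - of_nat n * shifted_legendre_diff n k)"
    by (intro sum.cong refl) (simp add: shifted_legendre_conv_diff algebra_simps)
  also have "\<dots> = of_nat n * (-1) ^ n"
    using sum_shifted_legendre_diff[OF assms]
    by (simp add: sum_subtractf sum_distrib_left [symmetric] sum_shifted_legendre)
  finally show ?thesis
    using assms by (simp add: field_simps power2_eq_square)
qed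

lemma sum_shifted_legendre_diff_harmonic_double:
  assumes "n > 0"
  shows "(\<Sum>k\<le>n. shifted_legendre_diff n k * harmonic (2 * k)) =
    (-1) ^ n / of_nat n - 1 / (2 * of_nat n)"
proof -
  \<comment> \<open>The even reciprocal is half a harmonic increment and is covered by the preceding
    lemma; only the odd reciprocal is new.\<close>
  have h: "harmonic (2 * Suc k) - harmonic (2 * k) =
      1 / of_nat (2 * k + 1) + (harmonic (Suc k) - harmonic k) / 2" for k
    by (simp add: harmonic_Suc divide_simps) (simp add: algebra_simps)
  have "of_nat n ^ 2 * (\<Sum>k\<le>n. shifted_legendre_diff n k * harmonic (2 * k)) =
      (\<Sum>k<n. of_nat (Suc k) ^ 2 * shifted_legendre_diff n (Suc k) / of_nat (2 * k + 1)) +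
      (\<Sum>k<n. of_nat (Suc k) ^ 2 * shifted_legendre_diff n (Suc k) * (harmonic (Suc k) - harmonic k)) / 2"
    unfolding sum_shifted_legendre_diff_weighted[of n "\<lambda>k. harmonic (2 * k)"] h
    by (simp only: distrib_left sum.distrib sum_divide_distrib times_divide_eq_right mult_1_right)
  also have "(\<Sum>k<n. of_nat (Suc k) ^ 2 * shifted_legendre_diff n (Suc k) * (harmonic (Suc k) - harmonic k))
      = of_nat n * (-1) ^ n"
    unfolding sum_shifted_legendre_diff_weighted [symmetric] sum_shifted_legendre_diff_harmonic[OF assms]
    using assms by (simp add: power2_eq_square)
  also have "(\<Sum>k<n. of_nat (Suc k) ^ 2 * shifted_legendre_diff n (Suc k) / of_nat (2 * k + 1)) =
     (\<Sum>k<n. (of_nat k ^ 2 - of_nat n ^ 2) * shifted_legendre_diff n k / of_nat (2 * k + 1))"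
    unfolding shifted_legendre_diff_Suc ..
  also have "\<dots> = (\<Sum>k\<le>n. (of_nat k ^ 2 - of_nat n ^ 2) * shifted_legendre_diff n k / of_nat (2 * k + 1))"
    unfolding lessThan_Suc_atMost [symmetric] by simp
  also have "\<dots> = (\<Sum>k\<le>n. of_nat n / 2 * shifted_legendre n k -
     of_nat n / 2 * (of_nat (2 * n + 1) * (shifted_legendre n k / of_nat (2 * k + 1))))"
  proof (intro sum.cong refl)
    fix k
    \<comment> \<open>Factoring \<open>k^2 - n^2\<close> brings back
      \<open>shifted_legendre\<close>, and \<open>(k-n)/(2k+1) = 1/2 - (2n+1)/(2(2k+1))\<close>
      splits the term into two summable pieces.\<close>
    have "(of_nat k ^ 2 - of_nat n ^ 2) * shifted_legendre_diff n k =
       (of_nat k - of_nat n) * (of_nat n * shifted_legendre n k)"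
      unfolding shifted_legendre_conv_diff by (simp add: algebra_simps power2_eq_square)
    then show "(of_nat k ^ 2 - of_nat n ^ 2) * shifted_legendre_diff n k / of_nat (2 * k + 1) =
      of_nat n / 2 * shifted_legendre n k -
      of_nat n / 2 * (of_nat (2 * n + 1) * (shifted_legendre n k / of_nat (2 * k + 1)))"
      by (simp only:) (simp add: field_simps)
  qed
  also have "\<dots> = of_nat n / 2 * ((-1) ^ n - 1)"
    unfolding sum_subtractf sum_distrib_left [symmetric] sum_shifted_legendre sum_shifted_legendre_odd
    by (simp add: algebra_simps)
  finally have "of_nat n * (of_nat n * (\<Sum>k\<le>n. shifted_legendre_diff n k * harmonic (2 * k))) =
      of_nat n * ((-1) ^ n - 1 / 2)"
    by (simp add: field_simps power2_eq_square)
  then have "of_nat n * (\<Sum>k\<le>n. shifted_legendre_diff n k * harmonic (2 * k)) = (-1) ^ n - 1 / 2"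
    using assms by simp
  then show ?thesis
    using assms by (simp add: field_simps)
qed

definition alternating_harmonic :: "nat \<Rightarrow> rat" where
  "alternating_harmonic n = (\<Sum>j=1..n. (-1) ^ j / of_nat j)"

lemma sum_shifted_legendre_harmonic:
  "of_nat (2 * n + 1) * (\<Sum>k\<le>n. shifted_legendre n k * harmonic k / of_nat (2 * k + 1)) =
     2 * alternating_harmonic n"
proof (induction n)
  case 0
  then show ?case by (simp add: alternating_harmonic_def)
next
  case (Suc n)
  show ?case
    unfolding sum_shifted_legendre_step sum_shifted_legendre_diff_harmonic[OF zero_less_Suc] Suc.IH
    by (simp add: alternating_harmonic_def del: of_nat_Suc)
qed

lemma sum_shifted_legendre_harmonic_double:
  "of_nat (2 * n + 1) * (\<Sum>k\<le>n. shifted_legendre n k * harmonic (2 * k) / of_nat (2 * k + 1)) =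
     2 * alternating_harmonic n - harmonic n"
proof (induction n)
  case 0
  then show ?case by (simp add: alternating_harmonic_def)
next
  case (Suc n)
  show ?case
    unfolding sum_shifted_legendre_step sum_shifted_legendre_diff_harmonic_double[OF zero_less_Suc] Suc.IH
    by (simp add: alternating_harmonic_def harmonic_Suc field_simps del: of_nat_Suc)
qed

section \<open>Exponential generating functions of Bernoulli and Euler numbers\<close>

definition egf :: "(nat \<Rightarrow> rat) \<Rightarrow> rat fps" where
  "egf a = Abs_fps (\<lambda>i. a i / fact i)"

lemma egf_mult_exp_nth:
  "fact m * (egf a * fps_exp c) $ m = (\<Sum>j\<le>m. of_nat (m choose j) * a j * c ^ (m - j))"
  unfolding fps_mult_nth egf_def sum_distrib_left atLeast0AtMost
  by (intro sum.cong refl) (simp add: binomial_fact)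

lemma egf_nth: "fact m * egf a $ m = a m"
  by (simp add: egf_def)

lemma fps_rat_eqI:
  fixes f g :: "rat fps"
  assumes "\<And>m. fact m * f $ m = fact m * g $ m"
  shows "f = g"
  using assms by (intro fps_ext) simp

lemma egf_compose_linear:
  "egf a oo (fps_const c * fps_X) = egf (\<lambda>j. c ^ j * a j)"
  by (simp add: fps_compose_linear egf_def)

lemma sum_even_terms:
  fixes g :: "nat \<Rightarrow> rat"
  shows "(\<Sum>i\<le>m. g i * (1 + (-1) ^ i)) = 2 * (\<Sum>k\<le>m div 2. g (2 * k))"
proof -
  have "(\<Sum>i\<le>m. g i * (1 + (-1) ^ i)) = (\<Sum>i\<in>{i. i \<le> m \<and> even i}. 2 * g i)"
    by (intro sum.mono_neutral_cong_right) auto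
  also have "\<dots> = (\<Sum>k\<le>m div 2. 2 * g (2 * k))"
    by (rule sum.reindex_bij_witness[of _ "\<lambda>k. 2 * k" "\<lambda>i. i div 2"]) auto
  finally show ?thesis
    by (simp add: sum_distrib_left)
qed

text \<open>Adding \<open>fps_exp (-1)\<close> keeps only the even shifts, which is the defining
  recurrence doubled.\<close>

lemma euler_number_egf:
  "egf (\<lambda>m. of_int (euler_number m)) * (fps_exp 1 + fps_exp (-1)) = 2"
proof (rule fps_rat_eqI)
  fix m
  define E where "E = (\<lambda>m. rat_of_int (euler_number m))"
  have "fact m * (egf E * (fps_exp 1 + fps_exp (-1))) $ m =
      (\<Sum>j\<le>m. of_nat (m choose j) * E j * (1 + (-1) ^ (m - j)))"
    by (simp only: distrib_left fps_add_nth egf_mult_exp_nth sum.distrib power_one)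
  also have "\<dots> = (\<Sum>j\<le>m. of_nat (m choose j) * E (m - j) * (1 + (-1) ^ j))"
    by (rule sum.reindex_bij_witness[of _ "\<lambda>j. m - j" "\<lambda>j. m - j"])
       (auto simp: binomial_symmetric [symmetric])
  also have "\<dots> = 2 * (\<Sum>k\<le>m div 2. of_nat (m choose (2 * k)) * E (m - 2 * k))"
    by (rule sum_even_terms)
  also have "(\<Sum>k\<le>m div 2. of_nat (m choose (2 * k)) * E (m - 2 * k)) = (if m = 0 then 1 else 0)"
  proof (cases "m = 0")
    case True
    then show ?thesis by (simp add: E_def euler_number.simps)
  next
    case False
    have "{..m div 2} = insert 0 {1..m div 2}" by auto
    then show ?thesis
      using False euler_number.simps[of m] by (simp add: E_def)
  qed
  finally show "fact m * (egf E * (fps_exp 1 + fps_exp (-1))) $ m = fact m * (2 :: rat fps) $ m"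
    by (simp add: fps_numeral_nth)
qed

lemma bernoulli_number_egf: "egf bernoulli_number * (fps_exp 1 - 1) = fps_X"
proof (rule fps_rat_eqI)
  fix m :: nat
  have "fact m * (egf bernoulli_number * (fps_exp 1 - 1)) $ m =
      (\<Sum>j\<le>m. of_nat (m choose j) * bernoulli_number j) - bernoulli_number m"
    by (simp only: right_diff_distrib fps_sub_nth mult_1_right egf_mult_exp_nth egf_nth) simp
  also have "\<dots> = (\<Sum>j<m. of_nat (m choose j) * bernoulli_number j)"
    by (simp add: lessThan_Suc_atMost [symmetric])
  also have "\<dots> = (if m = 1 then 1 else 0)"
  proof (cases "m \<ge> 2")
    case True
    then have "{..<m} = {0..m-1}" by auto
    then show ?thesis
      using bernoulli_number_recurrence[OF True] True by simp
  next
    case False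
    then have "m = 0 \<or> m = 1" by auto
    then show ?thesis by (auto simp: bernoulli_number_0)
  qed
  finally show "fact m * (egf bernoulli_number * (fps_exp 1 - 1)) $ m = fact m * fps_X $ m"
    by (simp add: fps_X_def)
qed

text \<open>The value at 0 of the Euler polynomial of degree \<open>m\<close>.\<close>

definition euler_poly_0 :: "nat \<Rightarrow> rat" where
  "euler_poly_0 m = fact m * (2 * inverse (fps_exp 1 + 1)) $ m"

lemma fps_exp_add_1_nonzero: "fps_exp (c :: rat) + 1 \<noteq> 0"
proof
  assume "fps_exp c + 1 = 0"
  then have "(fps_exp c + 1) $ 0 = 0" by simp
  then show False by simp
qed

lemma fps_exp_diff_1_nonzero:
  assumes "c \<noteq> 0"
  shows "fps_exp (c :: rat) - 1 \<noteq> 0"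
proof
  assume "fps_exp c - 1 = 0"
  then have "(fps_exp c - 1) $ 1 = 0" by simp
  then show False using assms by simp
qed

lemma euler_poly_0_egf: "egf euler_poly_0 * (fps_exp 1 + 1) = 2"
proof -
  have "egf euler_poly_0 = 2 * inverse (fps_exp 1 + 1)"
    by (rule fps_ext) (simp add: egf_def euler_poly_0_def)
  then show ?thesis
    by (simp add: mult.assoc inverse_mult_eq_1)
qed

lemma euler_poly_0_egf_scaled: "egf (\<lambda>j. c ^ j * euler_poly_0 j) * (fps_exp c + 1) = 2"
proof -
  have "(egf euler_poly_0 * (fps_exp 1 + 1)) oo (fps_const c * fps_X) = 2 oo (fps_const c * fps_X)"
    by (simp only: euler_poly_0_egf)
  then show ?thesis
    by (simp add: fps_compose_mult_distrib fps_compose_add_distrib egf_compose_linear)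
qed

lemma bernoulli_number_egf_scaled:
  "egf (\<lambda>j. c ^ j * bernoulli_number j) * (fps_exp c - 1) = fps_const c * fps_X"
proof -
  have "(egf bernoulli_number * (fps_exp 1 - 1)) oo (fps_const c * fps_X) = fps_X oo (fps_const c * fps_X)"
    by (simp only: bernoulli_number_egf)
  then show ?thesis
    by (simp add: fps_compose_mult_distrib fps_compose_sub_distrib egf_compose_linear)
qed

text \<open>Because \<open>2/(e^t + 1) + 2/(e^(-t) + 1) = 2\<close>, the series is odd apart from
  its constant term.\<close>

lemma euler_poly_0_even:
  assumes "even m" "m > 0"
  shows "euler_poly_0 m = 0"
proof -
  let ?F = "egf euler_poly_0" and ?G = "egf (\<lambda>j. (-1) ^ j * euler_poly_0 j)"
  have "fps_exp 1 * (fps_exp (-1) + 1) = fps_exp 1 + (1 :: rat fps)"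
    by (simp add: distrib_left fps_exp_add_mult [symmetric])
  then have "?G * (fps_exp 1 + 1) = fps_exp 1 * (?G * (fps_exp (-1) + 1))"
    by (metis mult.left_commute)
  then have "(?F + ?G) * (fps_exp 1 + 1) = 2 * (fps_exp 1 + 1)"
    by (simp add: distrib_right euler_poly_0_egf euler_poly_0_egf_scaled del: One_nat_def)
  then have "?F + ?G = 2"
    using fps_exp_add_1_nonzero[of 1] by (simp only: mult_cancel_right) simp
  then have "(?F + ?G) $ m = (2 :: rat fps) $ m"
    by simp
  then show ?thesis
    using assms by (simp add: egf_def fps_numeral_nth)
qed

lemma euler_poly_0_recurrence:
  "(\<Sum>j\<le>m. of_nat (m choose j) * euler_poly_0 j) + euler_poly_0 m = (if m = 0 then 2 else 0)"
proof -
  have "fact m * (egf euler_poly_0 * (fps_exp 1 + 1)) $ m =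
      (\<Sum>j\<le>m. of_nat (m choose j) * euler_poly_0 j) + euler_poly_0 m"
    by (simp only: distrib_left fps_add_nth mult_1_right egf_mult_exp_nth egf_nth) simp
  then show ?thesis
    by (simp add: euler_poly_0_egf fps_numeral_nth split: if_splits)
qed

text \<open>Compares coefficients in \<open>2t/(e^t + 1) = 2t/(e^t - 1) - 4t/(e^(2t) - 1)\<close>,
  whose right side is twice the Bernoulli series at \<open>t\<close> minus the one at
  \<open>2t\<close>.\<close>

lemma euler_poly_0_bernoulli_number:
  "of_nat (Suc m) * euler_poly_0 m = 2 * (1 - 2 ^ Suc m) * bernoulli_number (Suc m)"
proof -
  let ?B = "egf bernoulli_number" and ?C = "egf (\<lambda>j. 2 ^ j * bernoulli_number j)"
  have exp2: "fps_exp 2 - 1 = (fps_exp 1 - 1) * (fps_exp 1 + (1 :: rat fps))"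
    using fps_exp_add_mult[of "1 :: rat" 1] by (simp add: algebra_simps)
  have "fps_X * egf euler_poly_0 * (fps_exp 2 - 1) =
      fps_X * (fps_exp 1 - 1) * (egf euler_poly_0 * (fps_exp 1 + 1))"
    by (simp only: exp2 mult_ac)
  also have "\<dots> = 2 * (fps_X * (fps_exp 1 + 1) - fps_const 2 * fps_X)"
    unfolding euler_poly_0_egf by (simp add: algebra_simps numeral_fps_const [symmetric])
  also have "\<dots> = 2 * (?B * (fps_exp 1 - 1) * (fps_exp 1 + 1) - ?C * (fps_exp 2 - 1))"
    by (simp only: bernoulli_number_egf bernoulli_number_egf_scaled)
  also have "\<dots> = 2 * (?B - ?C) * (fps_exp 2 - 1)"
    unfolding exp2 by (simp add: algebra_simps)
  finally have "fps_X * egf euler_poly_0 = 2 * (?B - ?C)"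
    using fps_exp_diff_1_nonzero[of 2] by (simp only: mult_cancel_right) simp
  then have "(fps_X * egf euler_poly_0) $ Suc m = (2 * (?B - ?C)) $ Suc m"
    by simp
  then have "egf euler_poly_0 $ m = 2 * (?B $ Suc m - ?C $ Suc m)"
    by (simp add: numeral_fps_const)
  then show ?thesis
    by (simp add: egf_def field_simps del: of_nat_Suc)
qed

text \<open>The geometric sum of \<open>(-1)^k e^((2k+1)t)\<close> is
  \<open>(1 - (-1)^n e^(2nt)) / (e^t + e^(-t))\<close>. Writing its end term with
  \<open>e^((2n+1)t) / (e^(2t) + 1)\<close> makes the expansion run in powers of
  \<open>2n+1\<close>, which will be \<open>p\<close>.\<close>

lemma sum_alternating_odd_powers:
  "2 * (\<Sum>k<n. (-1) ^ k * (of_nat (2 * k + 1) :: rat) ^ m) =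
   of_int (euler_number m) -
   (-1) ^ n * (\<Sum>j\<le>m. of_nat (m choose j) * (2 ^ j * euler_poly_0 j) * of_nat (2 * n + 1) ^ (m - j))"
proof -
  let ?G = "egf (\<lambda>m. of_int (euler_number m))" and ?F = "egf (\<lambda>j. 2 ^ j * euler_poly_0 j)"
  let ?C = "fps_exp 1 + fps_exp (-1) :: rat fps"
  let ?S = "\<Sum>k<n. (-1) ^ k * fps_exp (of_nat (2 * k + 1)) :: rat fps"
  have S: "?S * ?C = 1 - (-1) ^ n * fps_exp (of_nat (2 * n))"
  proof (induction n)
    case (Suc n)
    have "fps_exp (of_nat (2 * n + 1)) * ?C = fps_exp (of_nat (2 * Suc n)) + fps_exp (of_nat (2 * n))"
      by (simp add: distrib_left fps_exp_add_mult [symmetric] algebra_simps)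
    then show ?case
      using Suc by (simp add: distrib_right mult.assoc) (simp add: algebra_simps)
  qed simp
  have C: "fps_exp 2 + 1 = fps_exp 1 * ?C"
    by (simp add: distrib_left fps_exp_add_mult [symmetric])
  have C0: "?C \<noteq> 0"
  proof
    assume "?C = 0"
    then have "?C $ 0 = 0" by simp
    then show False by simp
  qed
  have "fps_exp (of_nat (2 * n + 1)) * ?F * ?C = fps_exp (of_nat (2 * n)) * (?F * (fps_exp 2 + 1))"
    unfolding C using fps_exp_add_mult[of "of_nat (2 * n) :: rat" 1] by (simp add: algebra_simps)
  also have "\<dots> = 2 * fps_exp (of_nat (2 * n))"
    by (simp add: euler_poly_0_egf_scaled)
  finally have "(?G - (-1) ^ n * (?F * fps_exp (of_nat (2 * n + 1)))) * ?C =
     2 * (1 - (-1) ^ n * fps_exp (of_nat (2 * n)))"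
    using euler_number_egf
    by (simp only: left_diff_distrib mult.assoc[of "(-1) ^ n"] mult.commute[of ?F]) (simp add: right_diff_distrib)
  also have "\<dots> = (2 * ?S) * ?C"
    by (simp only: S mult.assoc)
  finally have "2 * ?S = ?G - (-1) ^ n * (?F * fps_exp (of_nat (2 * n + 1)))"
    using C0 by (simp only: mult_cancel_right) simp
  then have "fact m * (2 * ?S) $ m = fact m * (?G - fps_const ((-1) ^ n) * (?F * fps_exp (of_nat (2 * n + 1)))) $ m"
    by (cases "even n") simp_all
  also have "\<dots> = of_int (euler_number m) -
     (-1) ^ n * (fact m * (?F * fps_exp (of_nat (2 * n + 1))) $ m)"
    by (simp only: fps_sub_nth fps_mult_left_const_nth right_diff_distrib egf_nth mult.left_commute[of "fact m"])
  also have "fact m * (2 * ?S) $ m = 2 * (\<Sum>k<n. (-1) ^ k * of_nat (2 * k + 1) ^ m)"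
  proof -
    have "((-1) ^ k * fps_exp (of_nat (2 * k + 1)) :: rat fps) $ m = (-1) ^ k * of_nat (2 * k + 1) ^ m / fact m" for k
      by (cases "even k") simp_all
    then show ?thesis
      by (simp add: numeral_fps_const fps_sum_nth sum_distrib_left)
  qed
  finally show ?thesis
    unfolding egf_mult_exp_nth .
qed

text \<open>The geometric sum with ratio \<open>-e^t\<close>. Oddness of \<open>N\<close> gives the
  end term a plus sign, so that its part free of \<open>N\<close> doubles
  \<open>euler_poly_0 m\<close> instead of cancelling it.\<close>

lemma sum_alternating_powers:
  assumes "odd N"
  shows "2 * (\<Sum>k<N. (-1) ^ k * (of_nat k :: rat) ^ m) =
    euler_poly_0 m + (\<Sum>j\<le>m. of_nat (m choose j) * euler_poly_0 j * of_nat N ^ (m - j))"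
proof -
  let ?F = "egf euler_poly_0" and ?S = "\<lambda>N. \<Sum>k<N. (-1) ^ k * fps_exp (of_nat k) :: rat fps"
  have S: "?S N * (fps_exp 1 + 1) = 1 - (-1) ^ N * fps_exp (of_nat N)" for N
  proof (induction N)
    case (Suc N)
    have "fps_exp (of_nat N) * (fps_exp 1 + 1) = fps_exp (of_nat (Suc N)) + fps_exp (of_nat N :: rat)"
      by (simp add: distrib_left fps_exp_add_mult [symmetric] algebra_simps)
    then show ?case
      using Suc by (simp add: distrib_right mult.assoc) (simp add: algebra_simps)
  qed simp
  have "(?F + ?F * fps_exp (of_nat N)) * (fps_exp 1 + 1) = 2 * (1 + fps_exp (of_nat N))"
    by (simp only: distrib_right mult.assoc mult.commute[of "fps_exp (of_nat N)"])
       (simp only: mult.assoc [symmetric] distrib_right [symmetric] euler_poly_0_egf, simp add: distrib_left)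
  also have "\<dots> = (2 * ?S N) * (fps_exp 1 + 1)"
    using assms by (simp add: mult.assoc S)
  finally have "2 * ?S N = ?F + ?F * fps_exp (of_nat N)"
    using fps_exp_add_1_nonzero[of 1] by (simp only: mult_cancel_right) simp
  then have "fact m * (2 * ?S N) $ m = euler_poly_0 m + fact m * (?F * fps_exp (of_nat N)) $ m"
    by (simp only: fps_add_nth distrib_left egf_nth)
  also have "fact m * (2 * ?S N) $ m = 2 * (\<Sum>k<N. (-1) ^ k * of_nat k ^ m)"
  proof -
    have "((-1) ^ k * fps_exp (of_nat k) :: rat fps) $ m = (-1) ^ k * of_nat k ^ m / fact m" for k
      by (cases "even k") simp_all
    then show ?thesis
      by (simp add: numeral_fps_const fps_sum_nth sum_distrib_left)
  qed
  finally show ?thesis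
    unfolding egf_mult_exp_nth .
qed

section \<open>Congruences for harmonic sums\<close>

definition power_harmonic :: "nat \<Rightarrow> nat \<Rightarrow> rat" where
  "power_harmonic s m = (\<Sum>j=1..m. 1 / of_nat j ^ s)"

lemma power_harmonic_1: "power_harmonic 1 m = harmonic m"
  by (simp add: power_harmonic_def harmonic_def atLeastSucAtMost_greaterThanAtMost)

lemma sum_alternating_power_harmonic:
  "(\<Sum>k=1..2*m. (-1) ^ k / rat_of_nat k ^ s) =
     2 / 2 ^ s * power_harmonic s m - power_harmonic s (2 * m)"
  unfolding power_harmonic_def
proof (induction m)
  case (Suc m)
  have "rat_of_nat (Suc (Suc (2 * m))) ^ s = 2 ^ s * of_nat (Suc m) ^ s"
    by (simp add: power_mult_distrib [symmetric])
  then show ?case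
    using Suc by (simp add: algebra_simps del: of_nat_Suc)
qed simp

lemma central_binomial_Suc:
  "Suc k * ((2 * Suc k) choose Suc k) = 2 * (2 * k + 1) * ((2 * k) choose k)"
proof -
  have 1: "((2 * Suc k) choose Suc k) * Suc k = (2 * Suc k) * (Suc (2 * k) choose k)"
    using Suc_times_binomial_eq[of "Suc (2 * k)" k] by (simp only: mult_Suc_right add_2_eq_Suc)
  have "Suc (2 * k) choose k = Suc (2 * k) choose Suc k"
    using binomial_symmetric[of k "Suc (2 * k)"] by (simp add: Suc_diff_le)
  moreover have "(Suc (2 * k) choose Suc k) * Suc k = Suc (2 * k) * ((2 * k) choose k)"
    using Suc_times_binomial_eq[of "2 * k" k] by simp
  ultimately show ?thesis
    using 1 by (simp only: mult.commute mult.assoc mult.left_commute) (metis Suc_eq_plus1 mult.assoc mult.commute)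
qed

text \<open>Both sides equal \<open>(2m)!/m!\<close>, hence the two inductions on
  factorials.\<close>

lemma prod_odd_eq: "(\<Prod>i=1..m. 2 * (2 * rat_of_nat i - 1)) = (\<Prod>i=1..m. of_nat m + of_nat i)"
proof -
  have 1: "fact m * (\<Prod>i=1..m. 2 * (2 * rat_of_nat i - 1)) = fact (2 * m)"
  proof (induction m)
    case (Suc m)
    have "fact (Suc m) * (\<Prod>i=1..Suc m. 2 * (2 * rat_of_nat i - 1)) =
        of_nat (Suc m) * (2 * (2 * of_nat (Suc m) - 1)) * (fact m * (\<Prod>i=1..m. 2 * (2 * rat_of_nat i - 1)))"
      by (simp add: prod.nat_ivl_Suc' del: of_nat_Suc)
    then show ?case
      unfolding Suc.IH by (simp add: algebra_simps)
  qed simp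
  have "fact m * (\<Prod>i=1..k. rat_of_nat m + of_nat i) = fact (m + k)" for k
  proof (induction k)
    case (Suc k)
    have "fact m * (\<Prod>i=1..Suc k. rat_of_nat m + of_nat i) =
        of_nat (m + Suc k) * (fact m * (\<Prod>i=1..k. rat_of_nat m + of_nat i))"
      by (simp add: prod.nat_ivl_Suc' del: of_nat_Suc)
    then show ?case
      unfolding Suc.IH by simp
  qed simp
  from this[of m] have "fact m * (\<Prod>i=1..m. 2 * (2 * rat_of_nat i - 1)) =
      fact m * (\<Prod>i=1..m. of_nat m + of_nat i)"
    by (simp only: 1 mult_2[of m])
  then show ?thesis
    by (simp only: mult_cancel_left) simp
qed

section \<open>A fixed prime \<open>p = 2 * n + 1\<close> greater than 3\<close>

locale odd_prime_half =
  fixes p n :: nat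
  assumes prime: "prime p" and p_eq: "p = 2 * n + 1" and n_ge_2: "n \<ge> 2"
begin

abbreviation P :: rat where "P \<equiv> of_nat p"
abbreviation Zp :: "rat set" where "Zp \<equiv> localized_ints p"
abbreviation I :: "nat \<Rightarrow> rat set" where "I \<equiv> local_ideal p"

lemma p_pos: "p > 0"
  using p_eq by simp

lemma unit_nat: "0 < k \<Longrightarrow> k < p \<Longrightarrow> inverse (of_nat k) \<in> Zp"
  using inverse_of_nat_localized[OF prime] by blast

lemma unit_diff:
  assumes "0 < k" "k < p"
  shows "inverse (P - of_nat k) \<in> Zp"
  using unit_nat[of "p - k"] assms by (simp add: of_nat_diff)

lemma unit_diff_double:
  assumes "1 \<le> j" "j \<le> n"
  shows "inverse (P - 2 * of_nat j) \<in> Zp"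
  using unit_nat[of "p - 2 * j"] assms p_eq by (simp add: of_nat_diff)

lemma unit_2: "inverse 2 \<in> Zp"
  using unit_nat[of 2] p_eq n_ge_2 by simp

lemma unit_3: "inverse 3 \<in> Zp"
  using unit_nat[of 3] p_eq n_ge_2 by simp

lemma unit_4: "inverse 4 \<in> Zp"
  using unit_nat[of 4] p_eq n_ge_2 by simp

lemma unit_8: "inverse 8 \<in> Zp"
  using localized_ints_mult[OF unit_2 unit_4] by simp

lemmas units = unit_nat unit_diff unit_diff_double unit_2 unit_3 unit_4 unit_8

lemma I_cancel_unit:
  assumes "c * x \<in> I m" "inverse c \<in> Zp" "c \<noteq> 0"
  shows "x \<in> I m"
  using local_ideal_times[OF assms(2,1)] assms(3) by (simp add: mult.assoc [symmetric])

lemma P_times_I: "x \<in> I m \<Longrightarrow> P * x \<in> I (Suc m)"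
  using local_ideal_Suc_iff[OF p_pos] by blast

lemma P_times_I_1: "x \<in> Zp \<Longrightarrow> P * x \<in> I 1"
  by (rule local_idealI[of x]) simp_all

lemma P_times_I_2: "x \<in> I 1 \<Longrightarrow> P * x \<in> I 2"
  using P_times_I[of x 1] by (simp add: numeral_2_eq_2)

lemma P_times_I_3: "x \<in> I 2 \<Longrightarrow> P * x \<in> I 3"
  using P_times_I[of x 2] by (simp add: numeral_3_eq_3 numeral_2_eq_2)

lemma P_diff_double_nonzero: "P - 2 * of_nat k \<noteq> 0"
proof
  assume "P - 2 * of_nat k = 0"
  then have "rat_of_nat p = of_nat (2 * k)" by simp
  then have "p = 2 * k" by (simp only: of_nat_eq_iff)
  then show False by (simp add: p_eq) presburger
qed

lemma harmonic_localized: "m < p \<Longrightarrow> harmonic m \<in> Zp"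
  unfolding harmonic_def by (intro localized_ints_intros units) auto

lemma power_harmonic_localized: "m < p \<Longrightarrow> power_harmonic s m \<in> Zp"
  unfolding power_harmonic_def by (intro localized_ints_intros units) auto

lemma shifted_legendre_localized: "m < p \<Longrightarrow> shifted_legendre k m \<in> Zp"
  unfolding shifted_legendre_def by (intro localized_ints_intros units) auto

text \<open>As \<open>4n(n+1) = p^2 - 1\<close>, the prime enters these coefficients only through
  its square.\<close>

lemma shifted_legendre_eq:
  "shifted_legendre n k = (\<Prod>i=1..k. ((2 * of_nat i - 1) ^ 2 - P ^ 2) / (4 * of_nat i ^ 2))"
  unfolding shifted_legendre_def
proof (intro prod.cong refl)
  fix i
  have "of_nat i * (of_nat i - 1) - rat_of_nat n * (of_nat n + 1) = ((2 * of_nat i - 1) ^ 2 - P ^ 2) / 4"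
    by (simp add: p_eq power2_eq_square algebra_simps)
  then show "(of_nat i * (of_nat i - 1) - rat_of_nat n * (of_nat n + 1)) / of_nat i ^ 2 =
      ((2 * of_nat i - 1) ^ 2 - P ^ 2) / (4 * of_nat i ^ 2)"
    by (simp only: divide_divide_eq_left)
qed

text \<open>Consecutive terms have ratio \<open>(2i-1)^2 / (4i^2)\<close> on the binomial side, and
  the same with \<open>p^2\<close> subtracted in the numerator on the other;
  \<open>k \<le> n\<close> keeps every \<open>i\<close> a unit.\<close>

lemma central_binomial_square_cong:
  "k \<le> n \<Longrightarrow> of_nat ((2 * k) choose k) ^ 2 / 16 ^ k - shifted_legendre n k \<in> I 2"
proof (induction k)
  case 0
  then show ?case by (simp add: shifted_legendre_def)
next
  case (Suc k)
  let ?c = "\<lambda>k. rat_of_nat ((2 * k) choose k) ^ 2 / 16 ^ k" and ?r = "rat_of_nat (Suc k)"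
  have "?r * rat_of_nat ((2 * Suc k) choose Suc k) = 2 * (2 * ?r - 1) * of_nat ((2 * k) choose k)"
    using arg_cong[OF central_binomial_Suc[of k], of rat_of_nat]
    by (simp only: of_nat_mult) (simp add: algebra_simps del: binomial_Suc_Suc)
  then have "(?r * rat_of_nat ((2 * Suc k) choose Suc k)) ^ 2 = 4 * (2 * ?r - 1) ^ 2 * of_nat ((2 * k) choose k) ^ 2"
    by (simp only: power_mult_distrib) simp
  then have c: "?c (Suc k) = ?c k * ((2 * ?r - 1) ^ 2 / (4 * ?r ^ 2))"
    by (simp add: power_mult_distrib field_simps del: of_nat_Suc binomial_Suc_Suc)
  have a: "shifted_legendre n (Suc k) = shifted_legendre n k * (((2 * ?r - 1) ^ 2 - P ^ 2) / (4 * ?r ^ 2))"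
    unfolding shifted_legendre_eq by (simp add: prod.nat_ivl_Suc' mult.commute del: of_nat_Suc)
  have diff_mult: "c * (s / q) - a * ((s - t) / q) = s / q * (c - a) + a / q * t" for a c q s t :: rat
    by (simp add: diff_divide_distrib algebra_simps)
  have u: "inverse (4 * ?r ^ 2) \<in> Zp"
    using Suc.prems p_eq by (intro localized_ints_intros units) auto
  have "?c (Suc k) - shifted_legendre n (Suc k) =
     ((2 * ?r - 1) ^ 2 / (4 * ?r ^ 2)) * (?c k - shifted_legendre n k) +
     (shifted_legendre n k / (4 * ?r ^ 2)) * P ^ 2"
    unfolding a c by (rule diff_mult)
  moreover have "(2 * ?r - 1) ^ 2 / (4 * ?r ^ 2) \<in> Zp"
    by (intro localized_ints_divide[OF _ u] localized_ints_intros)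
  moreover have "shifted_legendre n k / (4 * ?r ^ 2) \<in> Zp"
    using Suc.prems p_eq by (intro localized_ints_divide[OF _ u] shifted_legendre_localized) simp
  ultimately show ?case
    using Suc by (simp only: Suc_leD local_ideal_add local_ideal_times local_ideal_power)
qed

text \<open>The termwise error in \<open>I 2\<close> moves to \<open>I 3\<close> on multiplication
  by \<open>p\<close>. In the closed form the same factor cancels the denominator
  \<open>2n+1\<close> of the term \<open>k = n\<close>, leaving
  \<open>shifted_legendre n n * w n\<close> to be subtracted.\<close>

lemma central_binomial_sum_cong:
  assumes "\<And>k. k < n \<Longrightarrow> w k \<in> Zp"
  shows "(\<Sum>k<n. of_nat ((2 * k) choose k) ^ 2 * w k / (of_nat (2 * k + 1) * 16 ^ k)) \<in> Zp"
    and "P * (\<Sum>k<n. of_nat ((2 * k) choose k) ^ 2 * w k / (of_nat (2 * k + 1) * 16 ^ k)) -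
     (P * (\<Sum>k\<le>n. shifted_legendre n k * w k / of_nat (2 * k + 1)) - shifted_legendre n n * w n) \<in> I 3"
proof -
  let ?S = "\<Sum>k<n. of_nat ((2 * k) choose k) ^ 2 * w k / (of_nat (2 * k + 1) * 16 ^ k)"
  have v: "w k / of_nat (2 * k + 1) \<in> Zp" if "k < n" for k
    using that p_eq assms by (intro localized_ints_intros units) auto
  have "of_nat ((2 * k) choose k) ^ 2 * w k / (of_nat (2 * k + 1) * 16 ^ k) \<in> Zp" if "k < n" for k
  proof -
    have "inverse 16 \<in> Zp"
      using localized_ints_mult[OF unit_4 unit_4] by simp
    then show ?thesis
      using that p_eq assms by (intro localized_ints_intros units) auto
  qed
  then show "?S \<in> Zp"
    by (intro localized_ints_sum) auto
  have "?S - (\<Sum>k<n. shifted_legendre n k * w k / of_nat (2 * k + 1)) =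
     (\<Sum>k<n. w k / of_nat (2 * k + 1) *
       (of_nat ((2 * k) choose k) ^ 2 / 16 ^ k - shifted_legendre n k))"
    unfolding sum_subtractf [symmetric]
    by (intro sum.cong refl) (simp add: right_diff_distrib mult_ac del: of_nat_Suc of_nat_add)
  also have "\<dots> \<in> I 2"
    using v by (intro local_ideal_sum local_ideal_times central_binomial_square_cong) auto
  finally have "P * (?S - (\<Sum>k<n. shifted_legendre n k * w k / of_nat (2 * k + 1))) \<in> I 3"
    by (rule P_times_I_3)
  moreover have "P * (shifted_legendre n n * w n / of_nat (2 * n + 1)) = shifted_legendre n n * w n"
    unfolding p_eq [symmetric] using p_pos by simp
  ultimately show "P * ?S -
     (P * (\<Sum>k\<le>n. shifted_legendre n k * w k / of_nat (2 * k + 1)) - shifted_legendre n n * w n) \<in> I 3"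
    by (simp add: lessThan_Suc_atMost [symmetric] algebra_simps del: of_nat_add of_nat_mult of_nat_Suc)
qed

text \<open>This number is \<open>(-1)^n binom(p-1, n)\<close>; reversing the order of the factors
  turns \<open>i - 1 - n\<close> into \<open>-i\<close> and \<open>i + n\<close> into
  \<open>p - i\<close>.\<close>

lemma shifted_legendre_self: "shifted_legendre n n = (\<Prod>j=1..n. 1 + (- P) / of_nat j)"
proof -
  have "shifted_legendre n n = (\<Prod>i=1..n. (of_nat i - 1 - of_nat n)) * (\<Prod>i=1..n. of_nat i + of_nat n) /
      (\<Prod>i=1..n. of_nat i ^ 2)"
    unfolding shifted_legendre_def prod.distrib [symmetric] prod_dividef [symmetric]
    by (intro prod.cong refl) (simp add: power2_eq_square algebra_simps)
  also have "(\<Prod>i=1..n. rat_of_nat i - 1 - of_nat n) = (\<Prod>i=1..n. - of_nat i)"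
    by (rule prod.reindex_bij_witness[of _ "\<lambda>i. n + 1 - i" "\<lambda>i. n + 1 - i"]) (auto simp: of_nat_diff)
  also have "(\<Prod>i=1..n. rat_of_nat i + of_nat n) = (\<Prod>i=1..n. P - of_nat i)"
    by (rule prod.reindex_bij_witness[of _ "\<lambda>i. n + 1 - i" "\<lambda>i. n + 1 - i"]) (auto simp: of_nat_diff p_eq)
  also have "(\<Prod>i=1..n. - of_nat i) * (\<Prod>i=1..n. P - of_nat i) / (\<Prod>i=1..n. of_nat i ^ 2) =
      (\<Prod>j=1..n. 1 + (- P) / of_nat j)"
    unfolding prod.distrib [symmetric] prod_dividef [symmetric]
    by (intro prod.cong refl) (simp add: power2_eq_square field_simps)
  finally show ?thesis .
qed

text \<open>In reversed order \<open>2j - p\<close> becomes \<open>-(2j - 1)\<close>, so the product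
  of odd numbers appears and \<open>prod_odd_eq\<close> leads back to
  \<open>shifted_legendre_self\<close>. The factor in front is \<open>2^(p-1)\<close>, the source of
  the Fermat quotient.\<close>

lemma shifted_legendre_self_half:
  "shifted_legendre n n = 2 ^ (2 * n) * (\<Prod>j=1..n. 1 + (- (P / 2)) / of_nat j)"
proof -
  have "2 ^ (2 * n) * (\<Prod>j=1..n. 1 + (- (P / 2)) / of_nat j) =
      (\<Prod>j=1..n. 4 * (1 + (- (P / 2)) / of_nat j))"
    unfolding prod.distrib by (simp add: power_mult)
  also have "\<dots> = (\<Prod>j=1..n. 2 * (2 * of_nat j - P)) / (\<Prod>j=1..n. of_nat j)"
    unfolding prod_dividef [symmetric] by (intro prod.cong refl) (simp add: field_simps)
  also have "(\<Prod>j=1..n. 2 * (2 * of_nat j - P)) = (\<Prod>j=1..n. (-1) * (2 * (2 * of_nat j - 1)))"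
    by (rule prod.reindex_bij_witness[of _ "\<lambda>i. n + 1 - i" "\<lambda>i. n + 1 - i"])
       (auto simp: of_nat_diff p_eq algebra_simps)
  also have "\<dots> = (\<Prod>j=1..n. -1) * (\<Prod>j=1..n. of_nat n + of_nat j)"
    by (subst prod.distrib) (simp only: prod_odd_eq)
  also have "(\<Prod>j=1..n. rat_of_nat n + of_nat j) = (\<Prod>j=1..n. P - of_nat j)"
    by (rule prod.reindex_bij_witness[of _ "\<lambda>i. n + 1 - i" "\<lambda>i. n + 1 - i"]) (auto simp: of_nat_diff p_eq)
  also have "(\<Prod>j=1..n. -1) * (\<Prod>j=1..n. P - of_nat j) / (\<Prod>j=1..n. of_nat j) =
      (\<Prod>j=1..n. 1 + (- P) / of_nat j)"
    unfolding prod.distrib [symmetric] prod_dividef [symmetric]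
    by (intro prod.cong refl) (simp add: field_simps)
  finally show ?thesis
    by (simp add: shifted_legendre_self)
qed

text \<open>The quadratic coefficient is the second elementary symmetric function of the
  reciprocals, rewritten by Newton's identity; all later terms contain \<open>x ^ 3\<close>.\<close>

lemma prod_one_plus_cong:
  assumes "x \<in> I 1" "m < p"
  shows "(\<Prod>j=1..m. 1 + x / of_nat j) -
    (1 + x * harmonic m + x ^ 2 * (harmonic m ^ 2 - power_harmonic 2 m) / 2) \<in> I 3"
  using assms(2)
proof (induction m)
  case 0
  then show ?case by (simp add: power_harmonic_def)
next
  case (Suc m)
  let ?E = "\<lambda>m. 1 + x * harmonic m + x ^ 2 * (harmonic m ^ 2 - power_harmonic 2 m) / 2"
  let ?j = "rat_of_nat (Suc m)"
  let ?z = "(harmonic m ^ 2 - power_harmonic 2 m) / (2 * ?j)"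
  have x: "x \<in> Zp"
    using assms(1) local_ideal_localized by blast
  have u: "1 + x / ?j \<in> Zp"
    using Suc.prems x by (intro localized_ints_intros units) auto
  have z: "?z \<in> Zp"
    using Suc.prems by (intro localized_ints_intros units harmonic_localized power_harmonic_localized) auto
  have x3: "x ^ 3 \<in> I 3"
    using local_ideal_mult[OF assms(1) local_ideal_mult[OF assms(1) assms(1)]]
    by (simp add: power3_eq_cube mult.assoc numeral_3_eq_3)
  have h2: "power_harmonic 2 (Suc m) = power_harmonic 2 m + 1 / ?j ^ 2"
    by (simp add: power_harmonic_def del: of_nat_Suc)
  have E: "?E (Suc m) = ?E m * (1 + x / ?j) - x ^ 3 * ?z"
    unfolding harmonic_Suc h2 by (simp add: field_simps power2_eq_square power3_eq_cube del: of_nat_Suc)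
  have "(\<Prod>j=1..Suc m. 1 + x / of_nat j) - ?E (Suc m) =
      (1 + x / ?j) * ((\<Prod>j=1..m. 1 + x / of_nat j) - ?E m) + ?z * x ^ 3"
    unfolding E by (simp add: prod.nat_ivl_Suc' algebra_simps del: of_nat_Suc)
  also have "\<dots> \<in> I 3"
    using Suc u x3 z by (intro local_ideal_add local_ideal_times) auto
  finally show ?case .
qed

section \<open>Pairing an index with its reflection \<open>p - k\<close>\<close>

lemma sum_reflect: "(\<Sum>k=1..2*n. f k) = (\<Sum>j=1..n. f j + f (p - j))"
  for f :: "nat \<Rightarrow> rat"
proof -
  have "{1..2*n} = {1..n} \<union> {n+1..2*n}" by auto
  then have "(\<Sum>k=1..2*n. f k) = (\<Sum>k=1..n. f k) + (\<Sum>k=n+1..2*n. f k)"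
    by (simp only:) (subst sum.union_disjoint, auto)
  also have "(\<Sum>k=n+1..2*n. f k) = (\<Sum>j=1..n. f (p - j))"
    by (rule sum.reindex_bij_witness[of _ "\<lambda>i. p - i" "\<lambda>i. p - i"]) (auto simp: p_eq)
  finally show ?thesis
    by (simp add: sum.distrib)
qed

lemma sum_flip: "(\<Sum>k=1..2*n. f k) = (\<Sum>k=1..2*n. f (p - k))"
  for f :: "nat \<Rightarrow> rat"
  by (rule sum.reindex_bij_witness[of _ "\<lambda>i. p - i" "\<lambda>i. p - i"]) (auto simp: p_eq)

lemma minus_one_power_diff: "j \<le> p \<Longrightarrow> (-1) ^ (p - j) = - ((-1 :: rat) ^ j)"
proof -
  have "odd p" by (simp add: p_eq)
  then show "j \<le> p \<Longrightarrow> ?thesis"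
    by (cases "even j") auto
qed

text \<open>The bases \<open>p - 2j\<close> are the odd numbers below \<open>p\<close>, those of the
  alternating power sums that produce Euler numbers.\<close>

abbreviation V :: rat where "V \<equiv> \<Sum>j=1..n. (-1) ^ j / (P - 2 * of_nat j) ^ 2"
abbreviation W :: rat where "W \<equiv> \<Sum>k=1..2*n. (-1) ^ k / of_nat k ^ 3"

lemma W_localized: "W \<in> Zp"
  using p_eq
  by (intro localized_ints_sum localized_ints_divide localized_ints_inverse_power units localized_ints_power
      localized_ints_minus) auto

text \<open>The alternating sum over the whole range is
  \<open>harmonic n - harmonic (2 * n)\<close>. Subtracting it in paired form from
  \<open>2 * alternating_harmonic n\<close> leaves the terms \<open>(-1)^j (1/j + 1/(p-j))\<close>.
  As \<open>4j(p-j) = p^2 - (p-2j)^2\<close>, the bracket is \<open>-4p/(p-2j)^2\<close> up to an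
  explicit multiple of \<open>p^3\<close>.\<close>

lemma alternating_harmonic_cong:
  "2 * alternating_harmonic n - harmonic n + harmonic (2 * n) + 4 * P * V \<in> I 3"
proof -
  let ?g = "\<lambda>j. (-1) ^ j / rat_of_nat j"
  have "(\<Sum>j=1..n. ?g j + ?g (p - j)) = harmonic n - harmonic (2 * n)"
    using sum_alternating_power_harmonic[of 1 n] unfolding sum_reflect
    by (simp add: power_harmonic_1 [simplified])
  then have "2 * alternating_harmonic n - harmonic n + harmonic (2 * n) + 4 * P * V =
     (\<Sum>j=1..n. 2 * ?g j - (?g j + ?g (p - j)) + 4 * P * ((-1) ^ j / (P - 2 * of_nat j) ^ 2))"
    unfolding sum.distrib sum_subtractf alternating_harmonic_def sum_distrib_left by simp
  also have "\<dots> \<in> I 3"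
  proof (rule local_ideal_sum)
    fix j assume j: "j \<in> {1..n}"
    then have nz: "rat_of_nat j \<noteq> 0" "P - of_nat j \<noteq> 0" "P - 2 * of_nat j \<noteq> 0"
      using p_eq P_diff_double_nonzero by auto
    have g: "?g (p - j) = - ((-1) ^ j / (P - of_nat j))"
    proof -
      have "j \<le> p" using j p_eq by auto
      then show ?thesis by (simp add: minus_one_power_diff of_nat_diff)
    qed
    show "2 * ?g j - (?g j + ?g (p - j)) + 4 * P * ((-1) ^ j / (P - 2 * of_nat j) ^ 2) \<in> I 3"
    proof (rule local_idealI)
      show "(-1) ^ j / (of_nat j * (P - of_nat j) * (P - 2 * of_nat j) ^ 2) \<in> Zp"
        using j p_eq
        by (intro localized_ints_divide localized_ints_inverse_mult localized_ints_inverse_power units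
            localized_ints_power localized_ints_minus) auto
      have "1 / of_nat j + 1 / (P - of_nat j) + 4 * P / (P - 2 * of_nat j) ^ 2 =
          P ^ 3 / (of_nat j * (P - of_nat j) * (P - 2 * of_nat j) ^ 2)"
        using nz by (simp add: divide_simps) (simp add: power2_eq_square power3_eq_cube algebra_simps)
      then have "(-1) ^ j * (1 / of_nat j + 1 / (P - of_nat j) + 4 * P / (P - 2 * of_nat j) ^ 2) =
          (-1) ^ j * (P ^ 3 / (of_nat j * (P - of_nat j) * (P - 2 * of_nat j) ^ 2))"
        by (simp only:)
      then show "2 * ?g j - (?g j + ?g (p - j)) + 4 * P * ((-1) ^ j / (P - 2 * of_nat j) ^ 2) =
          P ^ 3 * ((-1) ^ j / (of_nat j * (P - of_nat j) * (P - 2 * of_nat j) ^ 2))"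
        unfolding g by (simp add: algebra_simps)
    qed
  qed
  finally show ?thesis .
qed

text \<open>With \<open>m = j(p-j)\<close>, a pair contributes
  \<open>p/m + p(p^2 - 2m)/(2m^2) = p^3/(2m^2)\<close>: the factor \<open>P / 2\<close> is chosen so
  that the lower orders cancel.\<close>

lemma harmonic_cong_power_harmonic_2:
  "harmonic (2 * n) + P / 2 * power_harmonic 2 (2 * n) \<in> I 3"
proof -
  let ?g = "\<lambda>j. 1 / rat_of_nat j + P / 2 * (1 / rat_of_nat j ^ 2)"
  have "harmonic (2 * n) + P / 2 * power_harmonic 2 (2 * n) = (\<Sum>k=1..2*n. ?g k)"
    by (simp only: power_harmonic_1 [symmetric] power_harmonic_def sum.distrib sum_distrib_left) simp
  also have "\<dots> = (\<Sum>j=1..n. ?g j + ?g (p - j))"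
    by (rule sum_reflect)
  also have "\<dots> \<in> I 3"
  proof (rule local_ideal_sum)
    fix j assume j: "j \<in> {1..n}"
    then have nz: "rat_of_nat j \<noteq> 0" "P - of_nat j \<noteq> 0"
      using p_eq by auto
    show "?g j + ?g (p - j) \<in> I 3"
    proof (rule local_idealI)
      show "1 / (2 * (of_nat j * (P - of_nat j)) ^ 2) \<in> Zp"
        using j p_eq by (intro localized_ints_intros units) auto
      show "?g j + ?g (p - j) = P ^ 3 * (1 / (2 * (of_nat j * (P - of_nat j)) ^ 2))"
        using nz j p_eq by (simp add: of_nat_diff divide_simps)
          (simp add: power2_eq_square power3_eq_cube algebra_simps)
    qed
  qed
  finally show ?thesis .
qed

lemma inverse_square_reflect:
  assumes "0 < k" "k < p"
  shows "1 / of_nat k ^ 2 - 1 / (P - of_nat k) ^ 2 + 2 * P / of_nat k ^ 3 \<in> I 2"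
proof (rule local_idealI)
  have nz: "rat_of_nat k \<noteq> 0" "P - of_nat k \<noteq> 0"
    using assms by auto
  show "(2 * P - 3 * of_nat k) / (of_nat k ^ 3 * (P - of_nat k) ^ 2) \<in> Zp"
    using assms by (intro localized_ints_intros units) auto
  show "1 / of_nat k ^ 2 - 1 / (P - of_nat k) ^ 2 + 2 * P / of_nat k ^ 3 =
      P ^ 2 * ((2 * P - 3 * of_nat k) / (of_nat k ^ 3 * (P - of_nat k) ^ 2))"
    using nz by (simp add: divide_simps) (simp add: power2_eq_square power3_eq_cube algebra_simps)
qed

lemma power_harmonic_3_cong: "power_harmonic 3 (2 * n) \<in> I 1"
  unfolding power_harmonic_def sum_reflect
proof (rule local_ideal_sum)
  fix j assume j: "j \<in> {1..n}"
  then have nz: "rat_of_nat j \<noteq> 0" "P - of_nat j \<noteq> 0"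
    using p_eq by auto
  show "1 / of_nat j ^ 3 + 1 / of_nat (p - j) ^ 3 \<in> I 1"
  proof (rule local_idealI)
    show "(P ^ 2 - 3 * P * of_nat j + 3 * of_nat j ^ 2) / (of_nat j * (P - of_nat j)) ^ 3 \<in> Zp"
      using j p_eq by (intro localized_ints_intros units) auto
    show "1 / of_nat j ^ 3 + 1 / of_nat (p - j) ^ 3 =
        P ^ 1 * ((P ^ 2 - 3 * P * of_nat j + 3 * of_nat j ^ 2) / (of_nat j * (P - of_nat j)) ^ 3)"
      using nz j p_eq by (simp add: of_nat_diff divide_simps)
        (simp add: power2_eq_square power3_eq_cube algebra_simps)
  qed
qed

text \<open>Reflecting the alternating and the plain sum of inverse squares gives two linear
  relations modulo \<open>p^2\<close> between the half-range and full-range sums. Eliminating the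
  half-range sum leaves three times the full-range one.\<close>

lemma power_harmonic_2_cong:
  shows "3 * power_harmonic 2 (2 * n) + 4 * P * W \<in> I 2"
    and "power_harmonic 2 n \<in> I 1"
proof -
  let ?x = "power_harmonic 2 n" and ?y = "power_harmonic 2 (2 * n)"
  let ?z = "power_harmonic 3 n" and ?t = "power_harmonic 3 (2 * n)"
  let ?e = "\<lambda>k. 1 / of_nat k ^ 2 - 1 / (P - of_nat k) ^ 2 + 2 * P / of_nat k ^ 3"
  have Q: "(\<Sum>k=1..2*n. (-1) ^ k / rat_of_nat k ^ 2) = ?x / 2 - ?y"
    using sum_alternating_power_harmonic[of 2 n] by simp
  have Q': "(\<Sum>k=1..2*n. (-1) ^ k / rat_of_nat k ^ 2) = (\<Sum>k=1..2*n. - ((-1) ^ k / (P - of_nat k) ^ 2))"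
  proof (subst sum_flip, intro sum.cong refl)
    fix k assume "k \<in> {1..2*n}"
    then have "k \<le> p" using p_eq by auto
    then show "(-1) ^ (p - k) / rat_of_nat (p - k) ^ 2 = - ((-1) ^ k / (P - of_nat k) ^ 2)"
      by (simp add: minus_one_power_diff of_nat_diff)
  qed
  have "?x - 2 * ?y + 2 * P * W = (\<Sum>k=1..2*n. (-1) ^ k / rat_of_nat k ^ 2) +
     (\<Sum>k=1..2*n. - ((-1) ^ k / (P - of_nat k) ^ 2)) + 2 * P * W"
    unfolding Q' [symmetric] Q by simp
  also have "\<dots> = (\<Sum>k=1..2*n. (-1) ^ k * ?e k)"
    unfolding sum_distrib_left sum.distrib [symmetric] by (intro sum.cong refl) (simp add: algebra_simps)
  also have "\<dots> \<in> I 2"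
    using p_eq by (intro local_ideal_sum local_ideal_times inverse_square_reflect
        localized_ints_power localized_ints_minus) auto
  finally have b: "?x - 2 * ?y + 2 * P * W \<in> I 2" .
  have "?y = (\<Sum>j=1..n. 1 / of_nat j ^ 2 + 1 / (P - of_nat j) ^ 2)"
    unfolding power_harmonic_def sum_reflect
    by (intro sum.cong refl) (auto simp: of_nat_diff p_eq)
  then have "?y - 2 * ?x - 2 * P * ?z = (\<Sum>j=1..n. - ?e j)"
    unfolding power_harmonic_def sum_distrib_left
    by (simp only: sum_subtractf [symmetric]) (intro sum.cong refl, simp add: algebra_simps)
  also have "\<dots> \<in> I 2"
    using p_eq by (intro local_ideal_sum local_ideal_minus inverse_square_reflect) auto
  finally have c: "?y - 2 * ?x - 2 * P * ?z \<in> I 2" .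
  \<comment> \<open>Only \<open>P * ?z\<close> matters modulo \<open>p^2\<close>, and
    \<open>?t\<close> lies in \<open>I 1\<close>, so \<open>4 * W\<close> may replace
    \<open>?z\<close>.\<close>
  have d: "W = ?z / 4 - ?t"
    using sum_alternating_power_harmonic[of 3 n] by simp
  have Pt: "P * ?t \<in> I 2"
    by (rule P_times_I_2[OF power_harmonic_3_cong])
  have "3 * ?y + 4 * P * W =
      - ((?y - 2 * ?x - 2 * P * ?z) + 2 * (?x - 2 * ?y + 2 * P * W)) - 8 * (P * ?t)"
    unfolding d by (simp add: algebra_simps)
  also have "\<dots> \<in> I 2"
    by (intro b c Pt local_ideal_diff local_ideal_minus local_ideal_add local_ideal_times) simp_all
  finally show y: "3 * ?y + 4 * P * W \<in> I 2" .
  have PW: "P * W \<in> I 1"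
    using P_times_I_1[OF W_localized] .
  have "3 * ?y = (3 * ?y + 4 * P * W) - 4 * (P * W)"
    by simp
  also have "\<dots> \<in> I 1"
    by (intro local_ideal_mono[OF y, of 1] PW local_ideal_diff local_ideal_times) simp_all
  finally have y1: "?y \<in> I 1"
    using I_cancel_unit[of 3] unit_3 by simp
  have "?x = (?x - 2 * ?y + 2 * P * W) + 2 * ?y - 2 * (P * W)"
    by simp
  also have "\<dots> \<in> I 1"
    by (intro local_ideal_mono[OF b, of 1] PW y1 local_ideal_diff local_ideal_add local_ideal_times) simp_all
  finally show "?x \<in> I 1" .
qed

lemma harmonic_cong: "harmonic (2 * n) - 2 / 3 * P ^ 2 * W \<in> I 3"
proof -
  let ?y = "power_harmonic 2 (2 * n)"
  have "harmonic (2 * n) - 2 / 3 * P ^ 2 * W =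
      (harmonic (2 * n) + P / 2 * ?y) - (1 / 2) * ((1 / 3) * (P * (3 * ?y + 4 * P * W)))"
    by (simp add: algebra_simps power2_eq_square)
  also have "\<dots> \<in> I 3"
    by (intro local_ideal_diff local_ideal_times localized_ints_divide units
        P_times_I_3 power_harmonic_2_cong(1) harmonic_cong_power_harmonic_2) simp_all
  finally show ?thesis .
qed

section \<open>Fermat quotients, Bernoulli and Euler numbers\<close>

lemma fermat_power:
  assumes "0 < k" "k < p"
  shows "rat_of_nat k ^ (2 * n * t) - 1 \<in> I 1"
proof -
  have "\<not> p dvd k"
    using assms by (simp add: nat_dvd_not_less)
  then have "[k ^ (2 * n) = 1] (mod p)"
    using fermat_theorem[OF prime] p_eq by simp
  then have "[int (k ^ (2 * n)) ^ t = 1 ^ t] (mod int p)"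
    by (intro cong_pow) (simp flip: cong_int_iff)
  then have "int p dvd int (k ^ (2 * n)) ^ t - 1"
    by (simp add: cong_iff_dvd_diff)
  then have "rat_of_int (int (k ^ (2 * n)) ^ t - 1) \<in> I 1"
    by (rule local_ideal_of_int)
  then show ?thesis
    by (simp add: power_mult)
qed

abbreviation q :: rat where "q \<equiv> fermat_quotient p 2"

lemma P_fermat_quotient: "P * q = 2 ^ (2 * n) - 1"
  using p_pos by (simp add: fermat_quotient_def) (simp add: p_eq)

lemma power_2_cong: "2 ^ (2 * n * t) - 1 \<in> I 1"
  using fermat_power[of 2 t] p_eq n_ge_2 by simp

lemma fermat_quotient_localized: "q \<in> Zp"
proof -
  have "P * q \<in> I (Suc 0)"
    using power_2_cong[of 1] by (simp add: P_fermat_quotient)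
  then have "q \<in> I 0"
    by (simp only: local_ideal_Suc_iff[OF p_pos])
  then show ?thesis
    by (rule local_ideal_localized)
qed

text \<open>Comparing the two product formulas for \<open>shifted_legendre n n\<close> gives
  $\prod_{j \le n} (1 - p/(2j)) \equiv 2^{p-1}$ modulo $p^3$, which is Morley's congruence.\<close>

lemma morley_correction: "(shifted_legendre n n - 1) * harmonic n + 4 * P * q ^ 2 \<in> I 3"
proof -
  define h x N M where "h = harmonic n" and "x = power_harmonic 2 n"
    and "N = (\<Prod>j=1..n. 1 + (- (P / 2)) / of_nat j)" and "M = shifted_legendre n n"
  \<comment> \<open>Second-order expansions of \<open>N\<close> and \<open>M\<close> without
    \<open>x\<close>, which is divisible by \<open>p\<close> and occurs only with the factor
    \<open>P ^ 2\<close>.\<close>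
  define EN EM where "EN = 1 - P * h / 2 + P ^ 2 * h ^ 2 / 8" and "EM = 1 - P * h + P ^ 2 * h ^ 2 / 2"
  have h: "h \<in> Zp"
    using harmonic_localized p_eq by (simp add: h_def)
  have "P \<in> I 1"
    by (rule local_idealI[of 1]) simp_all
  moreover have "P / 2 \<in> I 1"
    by (rule local_idealI[OF unit_2]) (simp only: divide_inverse power_one_right)
  ultimately have P1: "- P \<in> I 1" "- (P / 2) \<in> I 1"
    by (simp_all only: local_ideal_minus)
  have P2x: "P ^ 2 * x \<in> I 3"
    using P_times_I_3[OF P_times_I_2[OF power_harmonic_2_cong(2)]]
    by (simp add: x_def power2_eq_square mult.assoc)
  have P3: "P ^ 3 * z \<in> I 3" if "z \<in> Zp" for z
    using that by (auto intro: local_idealI)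
  have n_less: "n < p"
    using p_eq by simp
  have M0: "M - (1 + (- P) * h + (- P) ^ 2 * (h ^ 2 - x) / 2) \<in> I 3"
    unfolding M_def shifted_legendre_self h_def x_def by (rule prod_one_plus_cong[OF P1(1) n_less])
  have N0: "N - (1 + (- (P / 2)) * h + (- (P / 2)) ^ 2 * (h ^ 2 - x) / 2) \<in> I 3"
    unfolding N_def h_def x_def by (rule prod_one_plus_cong[OF P1(2) n_less])
  have "M - EM = (M - (1 + (- P) * h + (- P) ^ 2 * (h ^ 2 - x) / 2)) - 1 / 2 * (P ^ 2 * x)"
    by (simp add: EM_def field_simps)
  also have "\<dots> \<in> I 3"
    by (intro M0 local_ideal_diff local_ideal_times P2x localized_ints_divide unit_2 localized_ints_1)
  finally have M: "M - EM \<in> I 3" .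
  have "N - EN = (N - (1 + (- (P / 2)) * h + (- (P / 2)) ^ 2 * (h ^ 2 - x) / 2)) - 1 / 8 * (P ^ 2 * x)"
    by (simp add: EN_def field_simps power_divide)
  also have "\<dots> \<in> I 3"
    by (intro N0 local_ideal_diff local_ideal_times P2x localized_ints_divide unit_8 localized_ints_1)
  finally have N: "N - EN \<in> I 3" .
  have EN_Zp: "EN \<in> Zp"
    unfolding EN_def using h by (intro localized_ints_intros unit_2 unit_8)
  then have N_Zp: "N \<in> Zp"
    using localized_ints_add[OF local_ideal_localized[OF N] EN_Zp] by simp
  \<comment> \<open>\<open>N\<close> has to be cancelled below, so it is shown to be a unit; each
    factor is \<open>-(p - 2j)/(2j)\<close>.\<close>
  have "inverse N = (\<Prod>j=1..n. inverse (1 + (- (P / 2)) / of_nat j))"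
    by (simp only: N_def prod_inversef [symmetric] comp_def)
  also have "\<dots> = (\<Prod>j=1..n. - (2 * of_nat j * inverse (P - 2 * of_nat j)))"
  proof (intro prod.cong refl)
    fix j assume "j \<in> {1..n}"
    then have "1 + (- (P / 2)) / of_nat j = - ((P - 2 * of_nat j) / (2 * of_nat j))"
      by (simp add: field_simps)
    then show "inverse (1 + (- (P / 2)) / of_nat j) = - (2 * of_nat j * inverse (P - 2 * of_nat j))"
      by (simp only: inverse_minus_eq inverse_divide divide_inverse[of "2 * of_nat j"])
  qed
  also have "\<dots> \<in> Zp"
    by (intro localized_ints_intros unit_diff_double) auto
  finally have N_unit: "inverse N \<in> Zp" .
  have N_nonzero: "N \<noteq> 0"
  proof -
    have "1 + (- (P / 2)) / of_nat j \<noteq> 0" if "j \<in> {1..n}" for j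
      using that P_diff_double_nonzero[of j] by (simp add: field_simps)
    then show ?thesis by (simp add: N_def)
  qed
  define a :: rat where "a = 2 ^ (2 * n)"
  have MN: "M = a * N"
    using shifted_legendre_self_half by (simp add: M_def N_def a_def)
  \<comment> \<open>Modulo \<open>p^3\<close>, \<open>EM\<close> is the square of \<open>EN\<close>.
    Together with \<open>M = a * N\<close>, cancelling \<open>N\<close> makes \<open>a\<close>
    congruent to \<open>N\<close>.\<close>
  have square: "1 - s + s ^ 2 / 2 - (1 - s / 2 + s ^ 2 / 8) ^ 2 = s ^ 3 / 8 * (1 - s / 8)" for s :: rat
    by (simp add: power2_eq_square power3_eq_cube field_simps)
  have "EM - EN ^ 2 = P ^ 3 * (h ^ 3 / 8 * (1 - P * h / 8))"
    using square[of "P * h"] by (simp add: EM_def EN_def power_mult_distrib)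
  moreover have "N * (a - N) = (M - EM) - (N + EN) * (N - EN) + (EM - EN ^ 2)"
    unfolding MN by (simp add: algebra_simps power2_eq_square)
  ultimately have "N * (a - N) = (M - EM) - (N + EN) * (N - EN) + P ^ 3 * (h ^ 3 / 8 * (1 - P * h / 8))"
    by (simp only:)
  also have "\<dots> \<in> I 3"
    by (intro M N EN_Zp N_Zp h local_ideal_add local_ideal_diff local_ideal_times P3 localized_ints_intros unit_8)
  finally have aN: "a - N \<in> I 3"
    using I_cancel_unit N_unit N_nonzero by blast
  \<comment> \<open>\<open>r\<close> is \<open>(EN - 1) / P\<close>, hence congruent to
    \<open>q\<close> modulo \<open>p^2\<close>.\<close>
  define r where "r = - h / 2 + P * h ^ 2 / 8"
  have r: "r \<in> Zp"
    unfolding r_def using h by (intro localized_ints_intros unit_2 unit_8)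
  have "P * (q - r) = (a - N) + (N - EN)"
    by (simp add: right_diff_distrib P_fermat_quotient a_def EN_def r_def algebra_simps power2_eq_square)
  also have "\<dots> \<in> I 3"
    using aN N by (rule local_ideal_add)
  finally have "P * (q - r) \<in> I (Suc 2)"
    by (simp add: numeral_3_eq_3)
  then have "q - r \<in> I 2"
    by (simp only: local_ideal_Suc_iff[OF p_pos])
  then have qr: "P * (q - r) \<in> I 3"
    by (rule P_times_I_3)
  \<comment> \<open>The orders \<open>P\<close> and \<open>P ^ 2\<close> cancel, which is why the
    bare square of the Fermat quotient suffices modulo \<open>p^3\<close>.\<close>
  have "(EM - 1) * h + 4 * P * r ^ 2 = P ^ 3 * (h ^ 4 / (2 * 8))"
    by (simp add: EM_def r_def field_simps power2_eq_square power3_eq_cube power4_eq_xxxx)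
  moreover have "(M - 1) * h + 4 * P * q ^ 2 =
      h * (M - EM) + 4 * (q + r) * (P * (q - r)) + ((EM - 1) * h + 4 * P * r ^ 2)"
    by (simp add: algebra_simps power2_eq_square)
  ultimately have "(M - 1) * h + 4 * P * q ^ 2 =
      h * (M - EM) + 4 * (q + r) * (P * (q - r)) + P ^ 3 * (h ^ 4 / (2 * 8))"
    by (simp only:)
  also have "\<dots> \<in> I 3"
    by (intro M qr h r fermat_quotient_localized local_ideal_add local_ideal_times P3 localized_ints_intros unit_8 unit_2)
  finally show ?thesis
    by (simp add: M_def h_def)
qed

text \<open>Solving the recurrence divides only by 2, so integrality holds in every degree, unlike
  for Bernoulli numbers; degrees close to \<open>2 * p\<close> do occur.\<close>

lemma euler_poly_0_localized: "euler_poly_0 m \<in> Zp"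
proof (induction m rule: less_induct)
  case (less m)
  have "(\<Sum>j\<le>m. of_nat (m choose j) * euler_poly_0 j) =
      (\<Sum>j<m. of_nat (m choose j) * euler_poly_0 j) + euler_poly_0 m"
    by (simp add: lessThan_Suc_atMost [symmetric])
  then have "euler_poly_0 m =
      ((if m = 0 then 2 else 0) - (\<Sum>j<m. of_nat (m choose j) * euler_poly_0 j)) / 2"
    using euler_poly_0_recurrence[of m] by (auto simp: field_simps split: if_splits)
  also have "\<dots> \<in> Zp"
    using less by (intro localized_ints_divide localized_ints_diff localized_ints_sum
        localized_ints_mult localized_ints_of_nat unit_2) auto
  finally show ?case .
qed

text \<open>In \<open>sum_alternating_powers\<close> with \<open>N = p\<close>, the terms
  \<open>j < m\<close> carry a factor \<open>p\<close>, so the power sum is congruent to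
  \<open>euler_poly_0 m\<close>. The exponent is -3 modulo \<open>p - 1\<close>, so Fermat turns
  \<open>k^m\<close> into \<open>1/k^3\<close>; \<open>m > 0\<close> removes the term
  \<open>k = 0\<close>.\<close>

lemma euler_poly_0_cong:
  assumes "m + 3 = 2 * n * t" "m > 0"
  shows "euler_poly_0 m - W \<in> I 1"
proof -
  let ?S = "\<Sum>k<p. (-1) ^ k * rat_of_nat k ^ m"
  have "odd p" by (simp add: p_eq)
  have "(\<Sum>j\<le>m. of_nat (m choose j) * euler_poly_0 j * P ^ (m - j)) =
      (\<Sum>j<m. of_nat (m choose j) * euler_poly_0 j * P ^ (m - j)) + euler_poly_0 m"
    by (simp add: lessThan_Suc_atMost [symmetric])
  then have "2 * (euler_poly_0 m - ?S) = - (\<Sum>j<m. of_nat (m choose j) * euler_poly_0 j * P ^ (m - j))"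
    using sum_alternating_powers[OF \<open>odd p\<close>, of m] by simp
  also have "\<dots> \<in> I 1"
  proof (intro local_ideal_minus local_ideal_sum local_ideal_times)
    fix j assume "j \<in> {..<m}"
    then show "P ^ (m - j) \<in> I 1"
      by (intro local_ideal_mono[OF local_ideal_power]) auto
  qed (intro localized_ints_intros euler_poly_0_localized)
  finally have 1: "euler_poly_0 m - ?S \<in> I 1"
    using I_cancel_unit[of 2] unit_2 by simp
  have "{..<p} = insert 0 {1..2*n}"
    using p_eq by auto
  then have "?S - W = (\<Sum>k=1..2*n. (-1) ^ k / of_nat k ^ 3 * (rat_of_nat k ^ (2 * n * t) - 1))"
    using assms(2) unfolding assms(1) [symmetric]
    by (simp only:) (simp add: sum_subtractf power_add right_diff_distrib)
  also have "\<dots> \<in> I 1"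
    using p_eq
    by (intro local_ideal_sum local_ideal_times fermat_power localized_ints_divide localized_ints_power
        localized_ints_minus localized_ints_inverse_power unit_nat) auto
  finally have "(euler_poly_0 m - ?S) + (?S - W) \<in> I 1"
    using 1 by (intro local_ideal_add)
  then show ?thesis by simp
qed

text \<open>The bound keeps every divisor met in the recursion below \<open>p\<close>.\<close>

lemma bernoulli_number_localized: "m + 2 \<le> p \<Longrightarrow> bernoulli_number m \<in> Zp"
proof (induction m rule: less_induct)
  case (less m)
  show ?case
  proof (cases "m = 0")
    case False
    have "- (\<Sum>k<m. of_nat (Suc m choose k) * bernoulli_number k) / of_nat (Suc m) \<in> Zp"
      using less by (intro localized_ints_divide localized_ints_minus localized_ints_sum
        localized_ints_mult localized_ints_of_nat unit_nat) auto
    then show ?thesis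
      using False by (subst bernoulli_number.simps) simp
  qed (simp add: bernoulli_number_0)
qed

section \<open>The Bernoulli number of index \<open>p - 3\<close>\<close>

abbreviation B :: rat where "B \<equiv> bernoulli_number (p - 3)"

lemma B_localized: "B \<in> Zp"
  using bernoulli_number_localized p_eq n_ge_2 by simp

text \<open>As \<open>4 * 2 ^ (p - 3) = 2 ^ (p - 1)\<close> is 1 modulo \<open>p\<close>, the
  relation between \<open>e = euler_poly_0 (p - 4)\<close> and \<open>B\<close> becomes
  \<open>-6 e = 3 B\<close> modulo \<open>p\<close>, and \<open>e\<close> is congruent to
  \<open>W\<close>.\<close>

lemma W_bernoulli_number: "2 * W + B \<in> I 1"
proof -
  define e and a :: rat where "e = euler_poly_0 (2 * n - 3)" and "a = 2 ^ (2 * n)"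
  have a1: "a - 1 \<in> I 1"
    using power_2_cong[of 1] by (simp add: a_def)
  have eW: "e - W \<in> I 1"
    unfolding e_def using n_ge_2 by (intro euler_poly_0_cong[of _ 1]) auto
  have p3: "Suc (2 * n - 3) = p - 3" "2 + (p - 3) = 2 * n" and of_nat_p3: "of_nat (p - 3) = P - 3"
    using p_eq n_ge_2 by (auto simp: of_nat_diff)
  have a: "a = 2 ^ 2 * 2 ^ (p - 3)"
    by (simp only: a_def power_add [symmetric] p3)
  have "(P - 3) * e = 2 * (1 - 2 ^ (p - 3)) * B"
    using euler_poly_0_bernoulli_number[of "2 * n - 3"] by (simp only: e_def p3 of_nat_p3)
  then have "2 * (P - 3) * e = (4 - a) * B"
    unfolding a by (simp add: algebra_simps)
  then have "3 * (2 * W + B) = 2 * (P * e) + B * (a - 1) - 6 * (e - W)"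
    by (simp add: algebra_simps)
  also have "\<dots> \<in> I 1"
    by (intro eW a1 local_ideal_diff local_ideal_add local_ideal_times P_times_I_1 B_localized)
       (simp_all add: e_def euler_poly_0_localized)
  finally show ?thesis
    using I_cancel_unit[of 3] unit_3 by simp
qed

section \<open>Euler numbers modulo \<open>p\<close> and \<open>p ^ 2\<close>\<close>

abbreviation U :: "nat \<Rightarrow> rat" where "U m \<equiv> \<Sum>j=1..n. (-1) ^ j * (P - 2 * of_nat j) ^ m"

text \<open>With bases \<open>2k+1 = p - 2(n-k)\<close> the odd power sum is \<open>U m\<close> up
  to sign, and the end term is a polynomial in \<open>p\<close>. Its constant coefficient vanishes
  by \<open>euler_poly_0_even\<close>; the linear one survives modulo \<open>p^2\<close>.\<close>

lemma euler_number_cong: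
  assumes "even m" "m \<ge> 2"
  shows "(-1) ^ n * of_int (euler_number m) - 2 * U m -
    P * (of_nat m * 2 ^ (m - 1) * euler_poly_0 (m - 1)) \<in> I 2"
proof -
  obtain r where m: "m = Suc (Suc r)"
    using assms(2) by (metis add_2_eq_Suc le_Suc_ex)
  let ?t = "\<lambda>j. of_nat (m choose j) * (2 ^ j * euler_poly_0 j) * P ^ (m - j)"
  have "(\<Sum>k<n. (-1) ^ k * (of_nat (2 * k + 1) :: rat) ^ m) =
      (\<Sum>j=1..n. (-1) ^ n * ((-1) ^ j * (P - 2 * of_nat j) ^ m))"
  proof (rule sum.reindex_bij_witness[of _ "\<lambda>j. n - j" "\<lambda>k. n - k"])
    fix k assume k: "k \<in> {..<n}"
    then have "P - 2 * of_nat (n - k) = of_nat (2 * k + 1)"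
      by (simp add: of_nat_diff p_eq)
    moreover have "(-1) ^ n * (-1) ^ (n - k) = ((-1) ^ k :: rat)"
    proof -
      have "n + (n - k) = 2 * (n - k) + k" using k by simp
      then show ?thesis by (simp only: power_add [symmetric]) (simp only: power_add power_mult, simp)
    qed
    ultimately show "(-1) ^ n * ((-1) ^ (n - k) * (P - 2 * of_nat (n - k)) ^ m) =
        (-1) ^ k * (of_nat (2 * k + 1) :: rat) ^ m"
      by (simp only: mult.assoc [symmetric])
  qed auto
  then have "2 * ((-1) ^ n * U m) = of_int (euler_number m) - (-1) ^ n * (\<Sum>j\<le>m. ?t j)"
    using sum_alternating_odd_powers[where n = n and m = m] by (simp only: sum_distrib_left [symmetric] p_eq [symmetric])
  then have "(-1) ^ n * (2 * ((-1) ^ n * U m)) =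
      (-1) ^ n * (of_int (euler_number m) - (-1) ^ n * (\<Sum>j\<le>m. ?t j))"
    by (simp only:)
  then have "2 * U m = (-1) ^ n * of_int (euler_number m) - (\<Sum>j\<le>m. ?t j)"
    by (cases "even n") (simp_all add: algebra_simps)
  moreover have "(\<Sum>j\<le>m. ?t j) = (\<Sum>j\<le>r. ?t j) + ?t (m - 1) + ?t m"
    by (simp add: m)
  moreover have "?t m = 0"
    using euler_poly_0_even assms by simp
  moreover have "?t (m - 1) = P * (of_nat m * 2 ^ (m - 1) * euler_poly_0 (m - 1))"
  proof -
    have "m choose (m - 1) = m"
      using binomial_symmetric[of 1 m] assms(2) by simp
    then show ?thesis
      using assms(2) by simp
  qed
  ultimately have "(-1) ^ n * of_int (euler_number m) - 2 * U m -
    P * (of_nat m * 2 ^ (m - 1) * euler_poly_0 (m - 1)) = (\<Sum>j\<le>r. ?t j)"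
    by linarith
  also have "\<dots> \<in> I 2"
  proof (intro local_ideal_sum local_ideal_times)
    fix j assume "j \<in> {..r}"
    then show "P ^ (m - j) \<in> I 2"
      by (intro local_ideal_mono[OF local_ideal_power]) (auto simp: m)
  qed (intro localized_ints_intros euler_poly_0_localized)
  finally show ?thesis .
qed

lemma fermat_power_diff_double:
  assumes "j \<in> {1..n}"
  shows "(P - 2 * of_nat j) ^ (2 * n) - 1 \<in> I 1"
proof -
  have "P - 2 * of_nat j = of_nat (p - 2 * j)"
    using assms p_eq by (simp add: of_nat_diff)
  moreover have "0 < p - 2 * j" "p - 2 * j < p"
    using assms p_eq by auto
  ultimately show ?thesis
    using fermat_power[of "p - 2 * j" 1] by (simp only: mult_1_right)
qed

abbreviation E :: "nat \<Rightarrow> rat" where "E m \<equiv> of_int (euler_number m)"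

lemma euler_number_combination_cong:
  "(-1) ^ n * (E (2 * p - 4) - 2 * E (p - 3)) + 2 * V - P * (W / 4) \<in> I 2"
proof -
  let ?m1 = "2 * p - 4" and ?m2 = "p - 3"
  have m1: "even ?m1" "?m1 \<ge> 2" "?m1 - 1 + 3 = 2 * n * 2" and m2: "even ?m2" "?m2 \<ge> 2" "?m2 - 1 + 3 = 2 * n * 1"
    using p_eq n_ge_2 by auto
  have of_nat_m: "rat_of_nat ?m1 = 2 * P - 4" "rat_of_nat ?m2 = P - 3"
    using p_eq n_ge_2 by (auto simp: of_nat_diff)
  define a e1 e2 where "a = (2 :: rat) ^ (2 * n)" and "e1 = euler_poly_0 (?m1 - 1)" and "e2 = euler_poly_0 (?m2 - 1)"
  have e: "e1 - W \<in> I 1" "e2 - W \<in> I 1"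
    unfolding e1_def e2_def using euler_poly_0_cong[OF m1(3)] euler_poly_0_cong[OF m2(3)] m1(2) m2(2)
    by simp_all
  have a: "a - 1 \<in> I 1"
    using power_2_cong[of 1] by (simp add: a_def)
  have a_Zp: "a \<in> Zp"
    unfolding a_def by (intro localized_ints_intros)
  have p1: "8 * 2 ^ (?m1 - 1) = a ^ 2"
  proof -
    have "8 * (2 :: rat) ^ (?m1 - 1) = 2 ^ (?m1 - 1 + 3)" by (simp only: power_add) simp
    then show ?thesis by (simp only: m1(3) a_def power_mult)
  qed
  have p2: "8 * 2 ^ (?m2 - 1) = a"
  proof -
    have "8 * (2 :: rat) ^ (?m2 - 1) = 2 ^ (?m2 - 1 + 3)" by (simp only: power_add) simp
    then show ?thesis by (simp only: m2(3) a_def mult_1_right)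
  qed
  \<comment> \<open>\<open>R\<close> collects the linear terms of both Euler expansions minus their
    expected value. Modulo \<open>p\<close> the degrees are -4 and -3 and each power of 2 is
    \<open>1/8\<close>, so the linear terms combine to \<open>(-4 + 6)/8 * W = W/4\<close>.\<close>
  define R where "R = of_nat ?m1 * 2 ^ (?m1 - 1) * e1 - 2 * (of_nat ?m2 * 2 ^ (?m2 - 1) * e2) - W / 4"
  have "8 * R = of_nat ?m1 * (8 * 2 ^ (?m1 - 1)) * e1 - 2 * (of_nat ?m2 * (8 * 2 ^ (?m2 - 1)) * e2) - 2 * W"
    by (simp add: R_def)
  also have "\<dots> = (2 * P - 4) * a ^ 2 * (e1 - W) - 2 * (P - 3) * a * (e2 - W) +
      W * (2 * P * a - 4 * (a + 1) + 6) * (a - 1)"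
    unfolding p1 p2 of_nat_m by (simp add: algebra_simps power2_eq_square)
  also have "\<dots> \<in> I 1"
    by (intro e a local_ideal_add local_ideal_diff local_ideal_times localized_ints_add localized_ints_diff
        localized_ints_mult localized_ints_power a_Zp W_localized) simp_all
  finally have R: "R \<in> I 1"
    using I_cancel_unit[of 8] unit_8 by simp
  have "U ?m1 - 2 * U ?m2 + V =
      (\<Sum>j=1..n. (-1) ^ j / (P - 2 * of_nat j) ^ 2 * ((P - 2 * of_nat j) ^ (2 * n) - 1) ^ 2)"
    unfolding sum_distrib_left sum.distrib [symmetric] sum_subtractf [symmetric]
  proof (intro sum.cong refl)
    fix j
    have combine: "c * (x ^ 2 / y) - 2 * (c * (x / y)) + c / y = c / y * (x - 1) ^ 2" for c x y :: rat
      by (simp add: power2_eq_square divide_inverse algebra_simps)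
    define u where "u = P - 2 * of_nat j"
    have u: "u \<noteq> 0"
      using P_diff_double_nonzero by (simp add: u_def)
    have "2 + ?m1 = 2 * n * 2" "2 + ?m2 = 2 * n"
      using p_eq n_ge_2 by auto
    then have "u ^ 2 * u ^ ?m1 = (u ^ (2 * n)) ^ 2" "u ^ 2 * u ^ ?m2 = u ^ (2 * n)"
      by (simp_all only: power_add [symmetric] power_mult [symmetric])
    then have "u ^ ?m1 = (u ^ (2 * n)) ^ 2 / u ^ 2" "u ^ ?m2 = u ^ (2 * n) / u ^ 2"
      using u by (simp_all add: field_simps)
    then show "(-1) ^ j * u ^ ?m1 - 2 * ((-1) ^ j * u ^ ?m2) + (-1) ^ j / u ^ 2 =
        (-1) ^ j / u ^ 2 * (u ^ (2 * n) - 1) ^ 2"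
      by (simp only: combine)
  qed
  also have "\<dots> \<in> I 2"
  proof (intro local_ideal_sum local_ideal_times)
    fix j assume j: "j \<in> {1..n}"
    show "((P - 2 * of_nat j) ^ (2 * n) - 1) ^ 2 \<in> I 2"
      using local_ideal_mult[OF fermat_power_diff_double[OF j] fermat_power_diff_double[OF j]]
      by (simp add: power2_eq_square numeral_2_eq_2)
    show "(-1) ^ j / (P - 2 * of_nat j) ^ 2 \<in> Zp"
      using j by (intro localized_ints_divide localized_ints_power localized_ints_minus
          localized_ints_inverse_power unit_diff_double) auto
  qed
  finally have UV: "U ?m1 - 2 * U ?m2 + V \<in> I 2" .
  let ?D = "\<lambda>m. (-1) ^ n * E m - 2 * U m - P * (of_nat m * 2 ^ (m - 1) * euler_poly_0 (m - 1))"
  have "(-1) ^ n * (E ?m1 - 2 * E ?m2) + 2 * V - P * (W / 4) =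
      ?D ?m1 - 2 * ?D ?m2 + 2 * (U ?m1 - 2 * U ?m2 + V) + P * R"
    unfolding R_def e1_def e2_def by (simp add: algebra_simps)
  also have "\<dots> \<in> I 2"
    by (intro UV P_times_I_2 R euler_number_cong[OF m1(1,2)] euler_number_cong[OF m2(1,2)]
        local_ideal_add local_ideal_diff local_ideal_times) simp_all
  finally show ?thesis .
qed

text \<open>A Kummer congruence, the indices differing by \<open>p - 1\<close>. Modulo
  \<open>p\<close> it collapses \<open>E (2 * p - 4) - 2 * E (p - 3)\<close> to
  \<open>- E (p - 3)\<close>, as the second claim requires.\<close>

lemma euler_number_kummer: "E (2 * p - 4) - E (p - 3) \<in> I 1"
proof -
  let ?m1 = "2 * p - 4" and ?m2 = "p - 3"
  have m1: "even ?m1" "?m1 \<ge> 2" and m2: "even ?m2" "?m2 \<ge> 2" and m12: "?m1 = ?m2 + 2 * n"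
    using p_eq n_ge_2 by auto
  have D: "(-1) ^ n * E m - 2 * U m \<in> I 1" if "even m" "m \<ge> 2" for m
  proof -
    let ?z = "of_nat m * 2 ^ (m - 1) * euler_poly_0 (m - 1)"
    have "?z \<in> Zp"
      by (intro localized_ints_intros euler_poly_0_localized)
    then have "((-1) ^ n * E m - 2 * U m - P * ?z) + P * ?z \<in> I 1"
      by (intro local_ideal_add local_ideal_mono[OF euler_number_cong[OF that]] P_times_I_1) auto
    then show ?thesis by simp
  qed
  have "U ?m1 - U ?m2 =
      (\<Sum>j=1..n. (-1) ^ j * (P - 2 * of_nat j) ^ ?m2 * ((P - 2 * of_nat j) ^ (2 * n) - 1))"
    unfolding sum_subtractf [symmetric] m12 power_add by (simp only: right_diff_distrib mult_ac mult_1_left)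
  also have "\<dots> \<in> I 1"
    by (intro local_ideal_sum local_ideal_times fermat_power_diff_double localized_ints_mult
        localized_ints_power localized_ints_minus localized_ints_diff) auto
  finally have U: "U ?m1 - U ?m2 \<in> I 1" .
  have "(-1) ^ n * (E ?m1 - E ?m2) =
      ((-1) ^ n * E ?m1 - 2 * U ?m1) - ((-1) ^ n * E ?m2 - 2 * U ?m2) + 2 * (U ?m1 - U ?m2)"
    by (simp add: algebra_simps)
  also have "\<dots> \<in> I 1"
    by (intro U D[OF m1] D[OF m2] local_ideal_add local_ideal_diff local_ideal_times) simp_all
  finally show ?thesis
    using I_cancel_unit[of "(-1) ^ n"] localized_ints_power[OF localized_ints_minus[OF localized_ints_1], of n]
    by (simp flip: power_inverse)
qed

text \<open>Euler's criterion gives the congruence modulo \<open>p\<close>; it is an equality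
  because the two sides differ by at most 2.\<close>

lemma Legendre_minus_one: "Legendre (-1) (int p) = (-1) ^ n"
proof -
  have p2: "p > 2"
    using p_eq n_ge_2 by simp
  have "[Legendre (-1) (int p) = (-1) ^ n] (mod int p)"
    using euler_criterion[OF prime p2, of "-1"] p_eq by simp
  then have "int p dvd Legendre (-1) (int p) - (-1) ^ n"
    by (simp add: cong_iff_dvd_diff)
  moreover have "\<bar>Legendre (-1) (int p) - (-1) ^ n\<bar> \<le> 2"
  proof -
    have "\<bar>Legendre (-1) (int p)\<bar> \<le> 1"
      by (simp add: Legendre_def)
    moreover have "\<bar>(-1) ^ n :: int\<bar> = 1"
      by (cases "even n") simp_all
    ultimately show ?thesis
      by linarith
  qed
  ultimately have "Legendre (-1) (int p) - (-1) ^ n = 0"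
    using p2 dvd_imp_le_int[of "Legendre (-1) (int p) - (-1) ^ n" "int p"] by linarith
  then show ?thesis
    by simp
qed

lemma central_binomial_harmonic_sum_congs:
  defines "S \<equiv> \<lambda>w. \<Sum>k<n. of_nat ((2*k) choose k) ^ 2 * w k / (of_nat (2*k + 1) * 16 ^ k)"
  shows "rat_cong p 2 (S harmonic)
           (4 * q ^ 2 + 2 * (-1) ^ n * (E (2*p - 4) - 2 * E (p - 3)) + 7 / 12 * P * B)"
    and "rat_cong p 1 (S (\<lambda>k. harmonic (2 * k))) (- 2 * (-1) ^ n * E (p - 3))"
proof -
  define X where "X = (-1) ^ n * (E (2*p - 4) - 2 * E (p - 3))"
  define M h H T where "M = shifted_legendre n n" and "h = harmonic n" and "H = harmonic (2 * n)"
    and "T = alternating_harmonic n"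
  define S1 S2 where "S1 = S harmonic" and "S2 = S (\<lambda>k. harmonic (2 * k))"
  have w1: "harmonic k \<in> Zp" and w2: "harmonic (2 * k) \<in> Zp" if "k < n" for k
    using that harmonic_localized p_eq by auto
  have s1: "S1 \<in> Zp" "P * S1 - (2 * T - M * h) \<in> I 3"
    using central_binomial_sum_cong[of harmonic, OF w1] sum_shifted_legendre_harmonic[of n]
    by (simp_all only: S1_def S_def p_eq [symmetric] T_def M_def h_def)
  have s2: "S2 \<in> Zp" "P * S2 - (2 * T - h - M * H) \<in> I 3"
    using central_binomial_sum_cong[of "\<lambda>k. harmonic (2 * k)", OF w2] sum_shifted_legendre_harmonic_double[of n]
    by (simp_all only: S2_def S_def p_eq [symmetric] T_def M_def h_def H_def)
  have Y: "2 * T - h + H + 4 * P * V \<in> I 3"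
    using alternating_harmonic_cong by (simp only: T_def h_def H_def)
  have Mh: "(M - 1) * h + 4 * P * q ^ 2 \<in> I 3"
    using morley_correction by (simp only: M_def h_def)
  have H: "H - 2 / 3 * P ^ 2 * W \<in> I 3"
    using harmonic_cong by (simp only: H_def)
  have X: "X + 2 * V - P * (W / 4) \<in> I 2"
    using euler_number_combination_cong by (simp only: X_def)
  have PX: "P * (X + 2 * V - P * (W / 4)) \<in> I 3"
    by (rule P_times_I_3[OF X])
  have WB: "P * (P * (2 * W + B)) \<in> I 3"
    by (intro P_times_I_3 P_times_I_2 W_bernoulli_number)
  have u12: "7 / 12 \<in> Zp"
    using localized_ints_mult[OF unit_3 unit_4] by (intro localized_ints_divide) simp_all
  let ?R1 = "4 * q ^ 2 + 2 * X + 7 / 12 * P * B" and ?R2 = "- 2 * (-1) ^ n * E (p - 3)"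
  \<comment> \<open>The coefficients are chosen so that \<open>T\<close>, \<open>M\<close>,
    \<open>h\<close>, \<open>H\<close>, \<open>V\<close> and \<open>W\<close> all cancel.\<close>
  have "P * (S1 - ?R1) = (P * S1 - (2 * T - M * h)) + (2 * T - h + H + 4 * P * V)
      - ((M - 1) * h + 4 * P * q ^ 2) - (H - 2 / 3 * P ^ 2 * W)
      - 2 * (P * (X + 2 * V - P * (W / 4))) - 7 / 12 * (P * (P * (2 * W + B)))"
    by (simp add: algebra_simps power2_eq_square)
  also have "\<dots> \<in> I 3"
    by (intro s1 Y Mh H PX WB u12 local_ideal_add local_ideal_diff local_ideal_times) simp_all
  finally have "P * (S1 - ?R1) \<in> I (Suc 2)"
    by (simp add: numeral_3_eq_3)
  then have "S1 - ?R1 \<in> I 2"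
    by (simp only: local_ideal_Suc_iff[OF p_pos])
  moreover have "?R1 \<in> Zp"
    unfolding X_def
    by (intro u12 B_localized fermat_quotient_localized localized_ints_add localized_ints_mult localized_ints_diff
        localized_ints_power localized_ints_minus) simp_all
  ultimately show "rat_cong p 2 (S harmonic)
      (4 * q ^ 2 + 2 * (-1) ^ n * (E (2*p - 4) - 2 * E (p - 3)) + 7 / 12 * P * B)"
    using s1(1) by (simp add: rat_cong_iff S1_def X_def mult.assoc)
  have M_Zp: "M \<in> Zp"
    using shifted_legendre_localized p_eq by (simp add: M_def)
  have "P ^ 2 * (2 / 3 * W) \<in> I 2"
    using W_localized by (intro local_idealI[of "2 / 3 * W"] localized_ints_mult localized_ints_divide unit_3) simp_all
  with local_ideal_mono[OF H, of 2] have "(H - 2 / 3 * P ^ 2 * W) + P ^ 2 * (2 / 3 * W) \<in> I 2"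
    by (intro local_ideal_add) auto
  then have H2: "H \<in> I 2"
    by (simp add: algebra_simps)
  have K: "P * ((-1) ^ n * (E (2 * p - 4) - E (p - 3))) \<in> I 2"
    by (intro P_times_I_2 local_ideal_times euler_number_kummer localized_ints_power localized_ints_minus) simp
  have P2W: "P * (P * (W / 2)) \<in> I 2"
    by (intro P_times_I_2 P_times_I_1 localized_ints_divide W_localized unit_2)
  \<comment> \<open>Here the weight of the term \<open>k = n\<close> is \<open>H\<close>, which
    already lies in \<open>I 2\<close>, so no Fermat quotient arises; the \<open>W\<close>
    correction is negligible too.\<close>
  have "P * (S2 - ?R2) = (P * S2 - (2 * T - h - M * H)) + (2 * T - h + H + 4 * P * V) - (1 + M) * H
     - 2 * (P * (X + 2 * V - P * (W / 4))) + 2 * (P * ((-1) ^ n * (E (2 * p - 4) - E (p - 3)))) - P * (P * (W / 2))"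
    by (simp add: X_def algebra_simps)
  also have "\<dots> \<in> I 2"
    by (intro local_ideal_mono[OF s2(2)] local_ideal_mono[OF Y] H2 local_ideal_mono[OF PX] K P2W M_Zp
      local_ideal_add local_ideal_diff local_ideal_times localized_ints_add) simp_all
  finally have "P * (S2 - ?R2) \<in> I (Suc 1)"
    by (simp add: numeral_2_eq_2)
  then have "S2 - ?R2 \<in> I 1"
    by (simp only: local_ideal_Suc_iff[OF p_pos])
  moreover have "?R2 \<in> Zp"
    by (intro localized_ints_mult localized_ints_power localized_ints_minus) simp_all
  ultimately show "rat_cong p 1 (S (\<lambda>k. harmonic (2 * k))) (- 2 * (-1) ^ n * E (p - 3))"
    using s2(1) by (simp add: rat_cong_iff S2_def)
qed

end

theorem theorem1p1:
  fixes p :: nat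
  assumes "prime p" and "p > 3"
  shows "rat_cong p 2
           (\<Sum>k=0..(p - 3) div 2.
              of_nat ((2*k) choose k) ^ 2 * harmonic k / (of_nat (2*k + 1) * 16 ^ k))
           (4 * fermat_quotient p 2 ^ 2
            + 2 * of_int (Legendre (-1) (int p))
                * of_int (euler_number (2*p - 4) - 2 * euler_number (p - 3))
            + 7 / 12 * of_nat p * bernoulli_number (p - 3))
         \<and> rat_cong p 1
           (\<Sum>k=0..(p - 3) div 2.
              of_nat ((2*k) choose k) ^ 2 * harmonic (2*k) / (of_nat (2*k + 1) * 16 ^ k))
           (- 2 * of_int (Legendre (-1) (int p)) * of_int (euler_number (p - 3)))"
proof -
  define n where "n = p div 2"
  have "odd p"
    using assms by (intro prime_odd_nat) auto
  then have "p = 2 * n + 1" "n \<ge> 2"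
    using assms(2) by (auto simp: n_def elim!: oddE)
  then interpret odd_prime_half p n
    using assms(1) by unfold_locales
  \<comment> \<open>The last index is \<open>n - 1\<close>: precisely the term with
    \<open>2k+1 = p\<close> is left out.\<close>
  have "{0..(p - 3) div 2} = {..<n}"
    using p_eq n_ge_2 by auto
  then show ?thesis
    using central_binomial_harmonic_sum_congs by (simp only: Legendre_minus_one) (simp add: mult.assoc)
qed

end
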